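(* Let the admissible triples $(\varepsilon,u_1,u_2)$, their lift coefficient $C_L$ and drag coefficient $C_D$, and the function $J_{\min}$ be as defined in the context. Then: (i) the maximum value of the lift coefficient $C_L$ over all admissible triples is $2/e$; (ii) for every given value $C_L\in(0,2/e]$, the global minimum of the drag coefficient $C_D$ over all admissible triples $(\varepsilon,u_1,u_2)$ having that lift coefficient is $$C_{D\min}=\frac{1}{2\pi}J_{\min}^2(C_L/2);$$ (iii) for every given value $C_L\in(0,2/e]$, the global maximum of the lift-to-drag ratio $\varkappa=C_L/C_D$ over all admissible triples having that lift coefficient is $$\varkappa_{\max}=\frac{2\pi C_L}{J_{\min}^2(C_L/2)}.$$
   Context: Here $e$ is the base of natural logarithms and $\log$ is the natural logarithm, with $0\log 0=0$. For a measurable $u:[0,1]\to[0,1]$ define $$I[u]=-\int_0^1u(\sigma)\log u(\sigma)\,d\sigma,\qquad J[u]=-\int_0^1\frac{u(\sigma)\log u(\sigma)}{\sqrt{\int_0^\sigma u(\sigma_1)\,d\sigma_1}}\,d\sigma,$$ the integrand of $J$ being taken as $0$ where $u(\sigma)=0$. An admissible triple $(\varepsilon,u_1,u_2)$ consists of a number $\varepsilon\in[0,1)$ and measurable functions $u_1,u_2:[0,1]\to[0,1]$. Its lift and drag coefficients are $$C_L=2\{(1-\varepsilon)I[u_2]-\varepsilon I[u_1]\},\qquad C_D=\frac{1}{2\pi}\left\{\sqrt{1-\varepsilon}\,J[u_2]+\sqrt{\varepsilon}\,J[u_1]\right\}^2.$$ (These describe a profile in Helmholtz--Kirchhoff infinite-cavity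 flow: $\varepsilon=l_1/l$ is the fraction of the wetted arc length $l$ lying on one side of the stagnation point, $u_1,u_2$ are the surface velocity distributions on the two sides of the stagnation point divided by the velocity at infinity, each as a function of normalized arc length from the stagnation point, and $u_1,u_2\le1$ is the Brillouin condition.) For $q\in(0,1/e]$, $J_{\min}(q)$ denotes the global minimum of $J[u]$ over all measurable $u:[0,1]\to[0,1]$ with $I[u]=q$. (Equivalently, setting $\lambda(\sigma)=\sqrt{2\int_0^\sigma u}$, it is the minimum of $-\sqrt2\int_0^1\lambda'\log(\lambda\lambda')\,d\sigma$ over absolutely continuous $\lambda$ with $\lambda(0)=0$, $\lambda'\ge0$, $\lambda\lambda'\le1$ and $-\int_0^1\lambda\lambda'\log(\lambda\lambda')\,d\sigma=q$.) *)

theory Defs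
  imports "HOL-Analysis.Analysis"
begin

text \<open>
  Functions on the unit interval are represented by functions on the reals; only their values
  on \<^term>\<open>{0..1::real}\<close> matter. Measurability is Lebesgue measurability.
\<close>

definition profile :: "(real \<Rightarrow> real) \<Rightarrow> bool" where
  "profile u \<longleftrightarrow> u \<in> borel_measurable (lebesgue_on {0..1}) \<and> u ` {0..1} \<subseteq> {0..1}"

text \<open>
  As \<^term>\<open>ln (0::real) = 0\<close> and division by zero yields zero, both integrands vanish where
  \<^term>\<open>u s = (0::real)\<close>. The set where \<^term>\<open>u s > (0::real)\<close> but the inner integral is zero
  is a null set.
\<close>

definition I_fun :: "(real \<Rightarrow> real) \<Rightarrow> real" where
  "I_fun u = - (LINT s|lebesgue_on {0..1}. u s * ln (u s))"

definition J_fun :: "(real \<Rightarrow> real) \<Rightarrow> real" where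
  "J_fun u = - (LINT s|lebesgue_on {0..1}. u s * ln (u s) / sqrt (LINT t|lebesgue_on {0..s}. u t))"

text \<open>
  The integral defining \<^term>\<open>J_fun\<close> is finite for every profile, so the default value of the
  Bochner integral for non-integrable functions plays no role.
\<close>

lemma xlnx_bound:
  fixes x :: real
  assumes "0 < x" "x \<le> 1"
  shows "- (x * ln x) \<le> sqrt x"
proof -
  let ?y = "sqrt x"
  have y: "?y > 0" using assms by simp
  have *: "ln (inverse ?y) = - (ln x / 2)" using assms by (simp add: ln_inverse ln_sqrt)
  have "ln (inverse ?y) \<le> inverse ?y / exp 1"
    using ln_le_minus_one[of "inverse ?y / exp 1"] y by (simp add: ln_div ln_inverse)
  then have "- ln x \<le> 2 / exp 1 * inverse ?y" 
    using * by simp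
  also have "\<dots> \<le> 1 * inverse ?y" 
    using exp_ge_add_one_self[of 1] y by (intro mult_right_mono) (auto simp: field_simps)
  finally have "x * (- ln x) \<le> x * inverse ?y" using assms by (intro mult_left_mono) auto
  also have "x * inverse ?y = ?y" using assms by (simp add: field_simps)
  finally show ?thesis by simp
qed

lemma integrable_J_fun:
  assumes "profile u"
  shows "integrable (lebesgue_on {0..1})
    (\<lambda>s. u s * ln (u s) / sqrt (LINT t|lebesgue_on {0..s}. u t))"
proof -
  define M where "M = lebesgue_on {0..1::real}"
  have spM [simp]: "space M = {0..1}" by (simp add: M_def)
  define U where "U s = (LINT t|lebesgue_on {0..s}. u t)" for s
  have um [measurable]: "u \<in> borel_measurable M" and u01: "\<And>s. s \<in> {0..1} \<Longrightarrow> 0 \<le> u s \<and> u s \<le> 1"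
    using assms by (auto simp: profile_def M_def image_subset_iff)
  have "finite_measure M"
    by (intro finite_measureI) (simp add: M_def emeasure_restrict_space)
  then have "integrable M (\<lambda>_. 1 :: real)"
    by (rule finite_measure.integrable_const)
  then have iM: "integrable M u"
    unfolding M_def
    by (rule measurable_bounded_by_integrable_imp_lebesgue_integrable[OF um[unfolded M_def]])
      (simp_all add: u01)
  have ii: "u integrable_on {0..1}" using iM unfolding M_def by (intro integrable_on_lebesgue_on) auto
  have iis: "integrable (lebesgue_on {0..s}) u" if "s \<in> {0..1}" for s
    using that by (intro integrable_subinterval[OF iM[unfolded M_def]]) auto
  have Uhk: "U s = integral {0..s} u" if "s \<in> {0..1}" for s
    unfolding U_def using iis[OF that] by (intro lebesgue_integral_eq_integral) auto
  have Ucont: "continuous_on {0..1} U"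
    using indefinite_integral_continuous_1[OF ii]
    by (rule continuous_on_eq) (simp add: Uhk)
  have iu: "u integrable_on {0..s}" if "s \<in> {0..1}" for s
    using iis[OF that] by (intro integrable_on_lebesgue_on) auto
  have U0: "U s \<ge> 0" if "s \<in> {0..1}" for s
    unfolding Uhk[OF that] using that u01 by (intro integral_nonneg iu) auto
  have U1: "U s \<le> 1" if "s \<in> {0..1}" for s
  proof -
    have "U s \<le> integral {0..s} (\<lambda>_. 1)" 
      unfolding Uhk[OF that] using that u01
      by (intro integral_le iu) auto
    then show ?thesis using that by simp
  qed
  have Um [measurable]: "U \<in> borel_measurable M"
    unfolding M_def using Ucont by (intro continuous_imp_measurable_on_sets_lebesgue) auto
  define A where "A k = {s \<in> {0..1}. (1/16)^(Suc k) < U s \<and> U s \<le> (1/16)^k}" for k :: nat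
  have Am [measurable]: "A k \<in> sets M" for k
  proof -
    have "A k = {s \<in> space M. (1/16)^(Suc k) < U s \<and> U s \<le> (1/16)^k}" by (simp add: A_def)
    also have "\<dots> \<in> sets M" by measurable
    finally show ?thesis .
  qed
  have Aint: "(\<integral>\<^sup>+ s. ennreal (u s) * indicator (A k) s \<partial>M) \<le> ennreal ((1/16)^k)" for k
  proof -
    define S where "S = {s \<in> {0..1}. U s \<le> (1/16)^k}"
    have "0 \<in> S" using U1 by (simp add: S_def Uhk)
    have "S = {0..1} \<inter> U -` {..(1/16)^k}" by (auto simp: S_def)
    moreover have "closed \<dots>" by (intro continuous_closed_preimage Ucont) auto
    ultimately have "compact S"
      by (metis Int_lower1 bounded_closed_interval bounded_subset compact_eq_bounded_closed)
    then obtain b where b: "b \<in> S" "\<And>s. s \<in> S \<Longrightarrow> s \<le> b"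
      using compact_attains_sup[of S] \<open>0 \<in> S\<close> by blast
    have b01: "b \<in> {0..1}" and Ub: "U b \<le> (1/16)^k" using b by (auto simp: S_def)
    have sub: "A k \<subseteq> {0..b}" using b by (auto simp: A_def S_def)
    have "(\<integral>\<^sup>+ s. ennreal (u s) * indicator (A k) s \<partial>M) \<le> (\<integral>\<^sup>+ s. ennreal (u s) * indicator {0..b} s \<partial>M)"
      using sub by (intro nn_integral_mono mult_left_mono) (auto simp: indicator_def)
    also have "\<dots> = (\<integral>\<^sup>+ s. ennreal (u s) \<partial>lebesgue_on {0..b})"
      using b01 by (auto simp: M_def nn_integral_restrict_space intro!: nn_integral_cong split: split_indicator)
    also have "\<dots> = ennreal (U b)"
      unfolding U_def using iis[OF b01] b01 u01
      by (intro nn_integral_eq_integral AE_I2) auto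
    also have "\<dots> \<le> ennreal ((1/16)^k)" using Ub by (rule ennreal_leI)
    finally show ?thesis .
  qed
  define f where "f s = u s * ln (u s) / sqrt (U s)" for s
  define g where "g s = (\<Sum>k. ennreal (12 * 8^k) * (ennreal (u s) * indicator (A k) s))" for s
  have pt: "ennreal (norm (f s)) \<le> 1 + g s" if s: "s \<in> {0..1}" for s
  proof (cases "u s = 0 \<or> U s = 0")
    case True
    then show ?thesis by (auto simp: f_def)
  next
    case False
    with u01[OF s] U0[OF s] have pos: "u s > 0" "U s > 0" by auto
    have nf: "norm (f s) = - (u s * ln (u s)) / sqrt (U s)"
      using pos u01[OF s] by (simp add: f_def abs_mult)
    show ?thesis
    proof (cases "u s \<le> U s")
      case True
      have "norm (f s) \<le> sqrt (u s) / sqrt (U s)"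
        unfolding nf using xlnx_bound[of "u s"] pos u01[OF s] by (intro divide_right_mono) auto
      also have "\<dots> \<le> 1" using True pos by simp
      finally have "ennreal (norm (f s)) \<le> 1" by simp
      then show ?thesis by (simp add: add_increasing2)
    next
      case uU: False
      define k where "k = (LEAST n. (1/16)^(Suc n) < U s)"
      obtain n where "(1/16)^n < U s"
        using real_arch_pow_inv[of "U s" "1/16"] pos by auto
      then have "(1/16)^(Suc n) < U s" using pos 
        by (simp add: field_simps) 
      then have k1: "(1/16)^(Suc k) < U s" unfolding k_def by (rule LeastI)
      have k2: "U s \<le> (1/16)^k"
      proof (cases k)
        case 0
        then show ?thesis using U1[OF s] by simp
      next
        case (Suc m)
        then have "\<not> (1/16)^(Suc m) < U s" unfolding k_def by (metis not_less_Least lessI)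
        then show ?thesis using Suc by simp
      qed
      have sA: "s \<in> A k" using s k1 k2 by (simp add: A_def)
      have "- ln (u s) \<le> - ln (U s)" using uU pos by simp
      also have "\<dots> \<le> - ln ((1/16)^(Suc k))" using k1 pos by (simp del: power_Suc)
      also have "\<dots> = real (Suc k) * ln 16" by (simp add: ln_realpow ln_div del: power_Suc)
      also have "\<dots> \<le> 2^k * 3"
      proof (intro mult_mono)
        have "ln (16::real) = 4 * ln 2" using ln_realpow[of 2 4] by simp
        then show "ln (16::real) \<le> 3" using ln2_le_25_over_36 by simp
        have "Suc k \<le> 2^k" using less_exp[of k] by (simp add: Suc_le_eq)
        then have "real (Suc k) \<le> real (2^k)" using of_nat_le_iff by blast
        then show "real (Suc k) \<le> 2^k" by simp
      qed auto
      finally have l: "- ln (u s) \<le> 2^k * 3" .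
      have sq: "inverse (sqrt (U s)) \<le> 4^(Suc k)"
      proof -
        have "sqrt ((1/16)^(Suc k)) \<le> sqrt (U s)" using k1 by (simp del: power_Suc)
        moreover have "sqrt ((1/16)^(Suc k)) = (1/4)^(Suc k)"
          by (simp add: real_sqrt_power real_sqrt_divide del: power_Suc)
        ultimately have "inverse (sqrt (U s)) \<le> inverse ((1/4)^(Suc k))"
          by (intro le_imp_inverse_le) (auto simp del: power_Suc)
        then show ?thesis by (simp add: power_one_over)
      qed
      have "norm (f s) = u s * ((- ln (u s)) * inverse (sqrt (U s)))"
        unfolding nf by (simp add: field_simps)
      also have "\<dots> \<le> u s * ((2^k * 3) * 4^(Suc k))"
        using l sq pos by (intro mult_left_mono mult_mono) auto
      also have "\<dots> = 12 * 8^k * u s"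
        using power_mult_distrib[of "2::real" 4 k] by simp
      finally have "ennreal (norm (f s)) \<le> ennreal (12 * 8^k) * (ennreal (u s) * indicator (A k) s)"
        using sA pos by (simp add: ennreal_mult[symmetric] ennreal_leI)
      also have "\<dots> \<le> g s"
        unfolding g_def
        using sum_le_suminf[of "\<lambda>k. ennreal (12 * 8^k) * (ennreal (u s) * indicator (A k) s)" "{k}"]
        by simp
      finally show ?thesis by (simp add: add_increasing)
    qed
  qed
  have "(\<integral>\<^sup>+ s. ennreal (norm (f s)) \<partial>M) \<le> (\<integral>\<^sup>+ s. 1 + g s \<partial>M)"
    by (intro nn_integral_mono pt) simp
  also have "\<dots> = 1 + (\<Sum>k. \<integral>\<^sup>+ s. ennreal (12 * 8^k) * (ennreal (u s) * indicator (A k) s) \<partial>M)"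
  proof -
    have "emeasure M {0..1} = 1" by (simp add: M_def emeasure_restrict_space)
    then show ?thesis unfolding g_def
      by (subst nn_integral_add) (simp_all add: nn_integral_suminf)
  qed
  also have "\<dots> \<le> 1 + (\<Sum>k. ennreal (12 * (1/2)^k))"
  proof (intro add_left_mono suminf_le)
    fix k
    have "(\<integral>\<^sup>+ s. ennreal (12 * 8^k) * (ennreal (u s) * indicator (A k) s) \<partial>M) 
        = ennreal (12 * 8^k) * (\<integral>\<^sup>+ s. ennreal (u s) * indicator (A k) s \<partial>M)"
      by (intro nn_integral_cmult) measurable
    also have "\<dots> \<le> ennreal (12 * 8^k) * ennreal ((1/16)^k)"
      by (intro mult_left_mono Aint) auto
    also have "\<dots> = ennreal (12 * (1/2)^k)"
      using power_mult_distrib[of 8 "1/16::real" k] by (simp add: ennreal_mult[symmetric])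
    finally show "(\<integral>\<^sup>+ s. ennreal (12 * 8^k) * (ennreal (u s) * indicator (A k) s) \<partial>M) \<le> ennreal (12 * (1/2)^k)" .
  qed auto
  also have "\<dots> < \<infinity>"
  proof -
    have "summable (\<lambda>k. 12 * (1/2::real)^k)" by (intro summable_mult summable_geometric) simp
    then show ?thesis by (simp add: ennreal_suminf_neq_top less_top[symmetric])
  qed
  finally have "(\<integral>\<^sup>+ s. ennreal (norm (f s)) \<partial>M) < \<infinity>" .
  moreover have "f \<in> borel_measurable M" unfolding f_def by measurable
  ultimately have "integrable M f" by (intro integrableI_bounded)
  then show ?thesis unfolding M_def f_def U_def .
qed

definition admissible :: "real \<Rightarrow> (real \<Rightarrow> real) \<Rightarrow> (real \<Rightarrow> real) \<Rightarrow> bool" where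
  "admissible \<epsilon> u\<^sub>1 u\<^sub>2 \<longleftrightarrow> 0 \<le> \<epsilon> \<and> \<epsilon> < 1 \<and> profile u\<^sub>1 \<and> profile u\<^sub>2"

definition C_L :: "real \<Rightarrow> (real \<Rightarrow> real) \<Rightarrow> (real \<Rightarrow> real) \<Rightarrow> real" where
  "C_L \<epsilon> u\<^sub>1 u\<^sub>2 = 2 * ((1 - \<epsilon>) * I_fun u\<^sub>2 - \<epsilon> * I_fun u\<^sub>1)"

definition C_D :: "real \<Rightarrow> (real \<Rightarrow> real) \<Rightarrow> (real \<Rightarrow> real) \<Rightarrow> real" where
  "C_D \<epsilon> u\<^sub>1 u\<^sub>2 = 1 / (2 * pi) * (sqrt (1 - \<epsilon>) * J_fun u\<^sub>2 + sqrt \<epsilon> * J_fun u\<^sub>1)\<^sup>2"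

definition is_minimum :: "real set \<Rightarrow> real \<Rightarrow> bool" where
  "is_minimum S m \<longleftrightarrow> m \<in> S \<and> (\<forall>x\<in>S. m \<le> x)"

definition is_maximum :: "real set \<Rightarrow> real \<Rightarrow> bool" where
  "is_maximum S m \<longleftrightarrow> m \<in> S \<and> (\<forall>x\<in>S. x \<le> m)"

text \<open>The attained minimum; the value is unspecified if no minimum exists.\<close>

definition J_min :: "real \<Rightarrow> real" where
  "J_min q = (THE m. is_minimum {J_fun u |u. profile u \<and> I_fun u = q} m)"

end

theory Submission
  imports Defs
begin

text \<open>
  With \<open>U s = \<integral>\<^sub>0\<^sup>s u\<close> as independent variable and \<open>w = - ln u\<close>, a profile with \<open>U 1 = V\<close> satisfies
  \<open>I = \<integral>\<^sub>0\<^sup>V w dU\<close>, \<open>J = \<integral>\<^sub>0\<^sup>V w / sqrt U dU\<close> and \<open>\<integral>\<^sub>0\<^sup>V exp w dU \<le> 1\<close>. After the rescaling \<open>y = U / V\<close> the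
  problem becomes convex, and Young's inequality
  \<open>exp w - (c - l / sqrt y) * w \<ge> K y - K y * ln (K y)\<close> with \<open>K y = max 1 (c - l / sqrt y)\<close> yields
  \<open>l * sqrt V * J - c * I + 1 \<ge> V * P\<close> with equality if \<open>exp w = K\<close>. If \<open>K 1 = exp 1\<close>, integration by
  parts identifies \<open>c * I - 1\<close> with \<open>m * P\<close>, where \<open>m\<close> is the value of \<open>V\<close> for \<open>exp w = K\<close>, and
  \<open>m + V \<ge> 2 * sqrt (m * V)\<close> shows that this extremal minimises \<open>J\<close> for its own value of \<open>I\<close>. The
  extremals form a one-parameter family along which \<open>I\<close> takes every value in \<open>(0, 1/e)\<close>.

  For a triple \<open>(\<epsilon>, u\<^sub>1, u\<^sub>2)\<close> the contribution of \<open>u\<^sub>1\<close> only spoils lift and drag. Compressing \<open>u\<^sub>2\<close> into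
  \<open>[0, t]\<close> and extending it by zero multiplies \<open>I\<close> by \<open>t\<close> and \<open>J\<close> by \<open>sqrt t\<close>, so a suitable
  \<open>t \<le> 1 - \<epsilon>\<close> produces a competitor for \<open>J_min (C_L / 2)\<close>.
\<close>

subsection \<open>Compressing a profile\<close>

lemma borel_measurable_lebesgue_scale:
  fixes f :: "real \<Rightarrow> real"
  assumes "f \<in> borel_measurable lebesgue"
  shows "(\<lambda>x. f (x / t)) \<in> borel_measurable lebesgue"
proof -
  have "(*\<^sub>R) (1 / t) = (\<lambda>x. x / t)"
    by (simp add: fun_eq_iff)
  then have "(\<lambda>x. x / t) \<in> lebesgue \<rightarrow>\<^sub>M lebesgue"
    using lebesgue_measurable_scaling[of "1 / t", where 'a = real] by (simp only:)
  from measurable_compose[OF this assms] show ?thesis .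
qed

text \<open>\<open>lebesgue\<close> has density t with respect to its own image under multiplication
  by t, so the substitution becomes a change of measure. Absorbing the interval into the integrand
  as \<open>h\<close> lets this act on the whole line.\<close>

lemma integral_lebesgue_on_scale:
  fixes g :: "real \<Rightarrow> real"
  assumes t: "0 < t" and g: "g \<in> borel_measurable (lebesgue_on {0..s})"
  shows "(LINT x|lebesgue_on {0..t * s}. g (x / t)) = t * (LINT x|lebesgue_on {0..s}. g x)"
proof -
  define h where "h x = indicator {0..s} x *\<^sub>R g x" for x
  have h: "h \<in> borel_measurable lebesgue"
    using g unfolding h_def by (subst (asm) borel_measurable_restrict_space_iff) auto
  have ht: "(\<lambda>x. h (x / t)) \<in> borel_measurable lebesgue"
    by (rule borel_measurable_lebesgue_scale[OF h])
  have "(*\<^sub>R) t = (*) t"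
    by (simp add: fun_eq_iff)
  then have mt: "(*) t \<in> lebesgue \<rightarrow>\<^sub>M lebesgue"
    using lebesgue_measurable_scaling[of t, where 'a = real] by (simp only:)
  have "(LINT x|lebesgue_on {0..t * s}. g (x / t)) = (LINT x|lebesgue. h (x / t))"
    using t by (auto simp: integral_restrict_space h_def indicator_def field_simps
        intro!: Bochner_Integration.integral_cong)
  also have "\<dots> = (LINT x|density (distr lebesgue lebesgue ((*) t)) (\<lambda>_. ennreal \<bar>t\<bar>). h (x / t))"
    using t by (subst lebesgue_real_scale[of t]) auto
  also have "\<dots> = (LINT x|distr lebesgue lebesgue ((*) t). \<bar>t\<bar> *\<^sub>R h (x / t))"
    using ht by (intro integral_density) auto
  also have "\<dots> = (LINT x|lebesgue. \<bar>t\<bar> *\<^sub>R h (t * x / t))"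
    using ht by (intro integral_distr mt) auto
  also have "\<dots> = t * (LINT x|lebesgue. h x)" using t by simp
  also have "(LINT x|lebesgue. h x) = (LINT x|lebesgue_on {0..s}. g x)"
    by (simp add: integral_restrict_space h_def)
  finally show ?thesis .
qed

lemma integral_lebesgue_on_cut:
  fixes f g :: "real \<Rightarrow> real"
  assumes "0 \<le> t" "t \<le> a"
    and "\<And>x. x \<in> {0..t} \<Longrightarrow> f x = g x" "\<And>x. x \<in> {t<..a} \<Longrightarrow> f x = 0"
  shows "(LINT x|lebesgue_on {0..a}. f x) = (LINT x|lebesgue_on {0..t}. g x)"
proof -
  have "indicator {0..a} x *\<^sub>R f x = indicator {0..t} x *\<^sub>R g x" for x
    using assms(1,2) assms(3,4)[of x] by (cases "x \<le> t") (auto simp: indicator_def)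
  then show ?thesis by (simp add: integral_restrict_space)
qed

lemma profile_measurable:
  assumes "profile u" "s \<le> 1"
  shows "u \<in> borel_measurable (lebesgue_on {0..s})"
  using assms unfolding profile_def by (auto elim: measurable_restrict_mono)

lemma profile_range:
  assumes "profile u" "s \<in> {0..1}"
  shows "0 \<le> u s" "u s \<le> 1"
  using assms by (auto simp: profile_def image_subset_iff)

definition squeeze :: "real \<Rightarrow> (real \<Rightarrow> real) \<Rightarrow> real \<Rightarrow> real" where
  "squeeze t u s = (if s \<le> t then u (s / t) else 0)"

lemma profile_squeeze:
  assumes u: "profile u" and t: "0 < t"
  shows "profile (squeeze t u)"
proof -
  have "(\<lambda>x. indicator {0..1} x *\<^sub>R u x) \<in> borel_measurable lebesgue"
    using u by (auto simp: profile_def borel_measurable_restrict_space_iff)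
  from borel_measurable_lebesgue_scale[OF this, of t]
  have "(\<lambda>x. indicator {0..1} (x / t) *\<^sub>R u (x / t)) \<in> borel_measurable (lebesgue_on {0..1})"
    by (rule measurable_restrict_space1)
  also have "?this \<longleftrightarrow> squeeze t u \<in> borel_measurable (lebesgue_on {0..1})"
    using t by (intro measurable_cong) (auto simp: squeeze_def field_simps indicator_def)
  finally show ?thesis
    using profile_range[OF u] t by (auto simp: profile_def squeeze_def divide_le_eq_1)
qed

lemma I_fun_squeeze:
  assumes u: "profile u" and t: "0 < t" "t \<le> 1"
  shows "I_fun (squeeze t u) = t * I_fun u"
proof -
  have "(LINT s|lebesgue_on {0..1}. squeeze t u s * ln (squeeze t u s))
      = (LINT s|lebesgue_on {0..t * 1}. u (s / t) * ln (u (s / t)))"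
    using t by (intro integral_lebesgue_on_cut) (auto simp: squeeze_def)
  also have "\<dots> = t * (LINT s|lebesgue_on {0..1}. u s * ln (u s))"
    using u t by (intro integral_lebesgue_on_scale) (auto simp: profile_def)
  finally show ?thesis by (simp add: I_fun_def)
qed

text \<open>The substitution contributes a factor t; the inner integral is itself multiplied by t
  and contributes 1 / sqrt t.\<close>

lemma J_fun_squeeze:
  assumes u: "profile u" and t: "0 < t" "t \<le> 1"
  shows "J_fun (squeeze t u) = sqrt t * J_fun u"
proof -
  define U where "U s = (LINT x|lebesgue_on {0..s}. u x)" for s
  have U: "(LINT x|lebesgue_on {0..s}. squeeze t u x) = t * U (s / t)" if "s \<in> {0..t}" for s
  proof -
    have "(LINT x|lebesgue_on {0..s}. squeeze t u x) = (LINT x|lebesgue_on {0..t * (s / t)}. u (x / t))"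
      using that t by (intro integral_lebesgue_on_cut) (auto simp: squeeze_def)
    also have "\<dots> = t * U (s / t)"
      unfolding U_def using that t by (intro integral_lebesgue_on_scale profile_measurable u) auto
    finally show ?thesis .
  qed
  \<comment> \<open>Measurability of the quotient comes from its integrability, after splitting off
    the constant 1 / sqrt t.\<close>
  have m: "(\<lambda>s. u s * ln (u s) / sqrt (t * U s)) \<in> borel_measurable (lebesgue_on {0..1})"
  proof -
    have "(\<lambda>s. 1 / sqrt t * (u s * ln (u s) / sqrt (U s))) \<in> borel_measurable (lebesgue_on {0..1})"
      unfolding U_def by (intro borel_measurable_times borel_measurable_const
          borel_measurable_integrable[OF integrable_J_fun[OF u]])
    then show ?thesis by (simp add: real_sqrt_mult)
  qed
  have "(LINT s|lebesgue_on {0..1}. squeeze t u s * ln (squeeze t u s) / sqrt (LINT x|lebesgue_on {0..s}. squeeze t u x))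
      = (LINT s|lebesgue_on {0..t * 1}. u (s / t) * ln (u (s / t)) / sqrt (t * U (s / t)))"
    using t by (intro integral_lebesgue_on_cut) (auto simp: U, auto simp: squeeze_def)
  also have "\<dots> = t * (LINT s|lebesgue_on {0..1}. u s * ln (u s) / sqrt (t * U s))"
    using t by (intro integral_lebesgue_on_scale m)
  also have "\<dots> = t * (1 / sqrt t * (LINT s|lebesgue_on {0..1}. u s * ln (u s) / sqrt (U s)))"
    by (subst integral_mult_right_zero[symmetric]) (simp add: real_sqrt_mult)
  also have "\<dots> = sqrt t * (LINT s|lebesgue_on {0..1}. u s * ln (u s) / sqrt (U s))"
    (is "t * (1 / sqrt t * ?A) = _")
  proof -
    have "t * (1 / sqrt t * ?A) = (t / sqrt t) * ?A" by simp
    then show ?thesis using t by (simp only: real_div_sqrt)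
  qed
  finally show ?thesis by (simp add: J_fun_def U_def)
qed

subsection \<open>The mass as independent variable\<close>

definition mass :: "(real \<Rightarrow> real) \<Rightarrow> real \<Rightarrow> real" where
  "mass u s = (LINT t|lebesgue_on {0..s}. u t)"

lemma integrable_bounded_unit:
  fixes f :: "real \<Rightarrow> real"
  assumes "f \<in> borel_measurable (lebesgue_on {a..b})" "\<And>s. s \<in> {a..b} \<Longrightarrow> \<bar>f s\<bar> \<le> B"
  shows "integrable (lebesgue_on {a..b}) f"
proof (rule measurable_bounded_by_integrable_imp_lebesgue_integrable[OF assms(1)])
  show "integrable (lebesgue_on {a..b}) (\<lambda>_. B)"
    by (intro finite_measure.integrable_const finite_measureI)
      (simp add: emeasure_restrict_space emeasure_lborel_Icc_eq)
qed (use assms(2) in auto)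

lemma profile_integrable:
  assumes "profile u" "s \<le> 1"
  shows "integrable (lebesgue_on {0..s}) u"
  using assms profile_range[OF assms(1)]
  by (intro integrable_bounded_unit[where B = 1] profile_measurable) auto

lemma mass_eq_integral:
  assumes "profile u" "s \<le> 1"
  shows "mass u s = integral {0..s} u" "u integrable_on {0..s}"
  using profile_integrable[OF assms]
  by (auto simp: mass_def lebesgue_integral_eq_integral intro: integrable_on_lebesgue_on)

lemma mass_0 [simp]: "profile u \<Longrightarrow> mass u 0 = 0"
  by (simp add: mass_eq_integral)

lemma mass_mono:
  assumes "profile u" "a \<le> b" "b \<le> 1"
  shows "mass u a \<le> mass u b"
  using assms profile_range[OF assms(1)] unfolding mass_eq_integral(1)[OF assms(1,3)] 
  by (subst mass_eq_integral(1)) (auto intro!: integral_subset_le mass_eq_integral(2))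

lemma mass_bounds:
  assumes "profile u" "s \<in> {0..1}"
  shows "0 \<le> mass u s" "mass u s \<le> s"
proof -
  show "0 \<le> mass u s" using mass_mono[of u 0 s] assms by simp
  have "integral {0..s} u \<le> integral {0..s} (\<lambda>_. 1)"
    using assms profile_range[OF assms(1)] by (intro integral_le mass_eq_integral(2)[OF assms(1)]) auto
  then show "mass u s \<le> s" using assms by (simp add: mass_eq_integral)
qed

lemma continuous_on_mass:
  assumes "profile u"
  shows "continuous_on {0..1} (mass u)"
  using indefinite_integral_continuous_1[OF mass_eq_integral(2)[OF assms order_refl]]
  by (rule continuous_on_eq) (simp add: mass_eq_integral assms)

lemma mass_measurable:
  assumes "profile u"
  shows "mass u \<in> borel_measurable (lebesgue_on {0..1})"
  using continuous_on_mass[OF assms] by (intro continuous_imp_measurable_on_sets_lebesgue) auto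

lemma nn_integral_profile:
  assumes "profile u" "s \<in> {0..1}"
  shows "(\<integral>\<^sup>+ x. ennreal (u x) * indicator {0..s} x \<partial>lebesgue_on {0..1}) = ennreal (mass u s)"
proof -
  have "(\<integral>\<^sup>+ x. ennreal (u x) * indicator {0..s} x \<partial>lebesgue_on {0..1})
      = (\<integral>\<^sup>+ x. ennreal (u x) \<partial>lebesgue_on {0..s})"
    using assms by (auto simp: nn_integral_restrict_space intro!: nn_integral_cong split: split_indicator)
  also have "\<dots> = ennreal (mass u s)"
    unfolding mass_def using assms profile_range[OF assms(1)]
    by (intro nn_integral_eq_integral profile_integrable AE_I2) auto
  finally show ?thesis .
qed

text \<open>The substitution \<open>y = mass u s\<close> as an image measure, since \<open>mass u\<close> is only Lipschitz.\<close>

lemma distr_mass: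
  assumes u: "profile u"
  shows "distr (density (lebesgue_on {0..1}) u) borel (mass u) = density lborel (indicator {0..mass u 1})"
    (is "?D = ?L")
proof (rule measure_eqI_lessThan)
  let ?M = "lebesgue_on {0..1::real}"
  define V where "V = mass u 1"
  note um [measurable] = profile_measurable[OF u order_refl] mass_measurable[OF u]
  have V0: "0 \<le> V" using mass_bounds[OF u, of 1] by (simp add: V_def)
  \<comment> \<open>The measures are compared on open upper half-lines, where \<open>?D\<close>
    integrates \<open>u\<close> over a superlevel set of its mass.\<close>
  have D: "emeasure ?D {x<..} = (\<integral>\<^sup>+ s. ennreal (u s) * indicator {s. x < mass u s} s \<partial>?M)" for x
  proof -
    have "emeasure ?D {x<..} = emeasure (density ?M u) {s \<in> space ?M. x < mass u s}"
      by (subst emeasure_distr) (auto intro!: arg_cong2[where f = emeasure])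
    also have "\<dots> = (\<integral>\<^sup>+ s. ennreal (u s) * indicator {s \<in> space ?M. x < mass u s} s \<partial>?M)"
      by (rule emeasure_density) measurable
    also have "\<dots> = (\<integral>\<^sup>+ s. ennreal (u s) * indicator {s. x < mass u s} s \<partial>?M)"
      by (intro nn_integral_cong) (auto split: split_indicator)
    finally show ?thesis .
  qed
  have L: "emeasure ?L {x<..} = emeasure lborel ({0..V} \<inter> {x<..})" for x
    by (simp add: emeasure_density V_def flip: indicator_inter_arith)
  show "emeasure ?D {x<..} = emeasure ?L {x<..}" for x
  proof -
    consider "x < 0" | "0 \<le> x" "x < V" | "V \<le> x" "0 \<le> x" by linarith
    then show ?thesis
    proof cases
      case 1
      have "emeasure ?D {x<..} = (\<integral>\<^sup>+ s. ennreal (u s) * indicator {0..1} s \<partial>?M)"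
        unfolding D using 1 mass_bounds(1)[OF u]
        by (intro nn_integral_cong) (fastforce split: split_indicator)
      also have "\<dots> = V" using nn_integral_profile[OF u, of 1] by (simp add: V_def)
      finally have "emeasure ?D {x<..} = V" .
      moreover have "{0..V} \<inter> {x<..} = {0..V}" using 1 by auto
      ultimately show ?thesis unfolding L using V0 by simp
    next
      case 2
      \<comment> \<open>The mass may be constant on intervals, so the last point \<open>b\<close> of
        the compact sublevel set is taken: the superlevel set is then exactly (b, 1], and it carries
        the mass V - x.\<close>
      define S where "S = {0..1} \<inter> mass u -` {..x}"
      obtain c where c: "0 \<le> c" "c \<le> 1" "mass u c = x"
        using IVT'[of "mass u" 0 x 1] 2 continuous_on_mass[OF u] u by (auto simp: V_def)
      then have "c \<in> S" by (simp add: S_def)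
      have "closed S" unfolding S_def by (intro continuous_closed_preimage continuous_on_mass u) auto
      then have "compact S"
        by (metis Int_lower1 S_def bounded_closed_interval bounded_subset compact_eq_bounded_closed)
      then obtain b where b: "b \<in> S" "\<And>s. s \<in> S \<Longrightarrow> s \<le> b"
        using compact_attains_sup[of S] \<open>c \<in> S\<close> by blast
      have b01: "b \<in> {0..1}" using b by (simp add: S_def)
      have "c \<le> b" using b(2)[of c] c by (simp add: S_def)
      then have bx: "mass u b = x" using mass_mono[OF u, of c b] b c by (auto simp: S_def)
      have A: "x < mass u s \<longleftrightarrow> b < s" if "s \<in> {0..1}" for s
        using b(2)[of s] that mass_mono[OF u, of s b] b01 bx by (auto simp: S_def not_less[symmetric])
      have "ennreal V = (\<integral>\<^sup>+ s. ennreal (u s) * indicator {0..1} s \<partial>?M)"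
        using nn_integral_profile[OF u, of 1] by (simp add: V_def)
      also have "\<dots> = (\<integral>\<^sup>+ s. ennreal (u s) * indicator {s \<in> space ?M. x < mass u s} s
          + ennreal (u s) * indicator {0..b} s \<partial>?M)"
        using A b01 by (intro nn_integral_cong) (fastforce split: split_indicator)
      also have "\<dots> = (\<integral>\<^sup>+ s. ennreal (u s) * indicator {s \<in> space ?M. x < mass u s} s \<partial>?M)
          + (\<integral>\<^sup>+ s. ennreal (u s) * indicator {0..b} s \<partial>?M)"
      proof (intro nn_integral_add)
        have "{0..b} = {s \<in> space ?M. \<not> x < mass u s}" using A b01 by auto
        moreover have "\<dots> \<in> sets ?M" by measurable
        ultimately have [measurable]: "{0..b} \<in> sets ?M" by simp
        show "(\<lambda>s. ennreal (u s) * indicator {0..b} s) \<in> borel_measurable ?M" by measurable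
      qed measurable
      also have "(\<integral>\<^sup>+ s. ennreal (u s) * indicator {s \<in> space ?M. x < mass u s} s \<partial>?M) = emeasure ?D {x<..}"
        unfolding D by (intro nn_integral_cong) (auto split: split_indicator)
      also have "(\<integral>\<^sup>+ s. ennreal (u s) * indicator {0..b} s \<partial>?M) = ennreal x"
        using nn_integral_profile[OF u b01] bx by simp
      finally have "emeasure ?D {x<..} = ennreal (V - x)"
        using 2 by (metis add_diff_eq_ennreal add_diff_self_ennreal diff_self ennreal_add_diff_cancel_right ennreal_minus ennreal_neq_top)
      moreover have "{0..V} \<inter> {x<..} = {x<..V}" using 2 by auto
      ultimately show ?thesis unfolding L using 2 by simp
    next
      case 3
      have "emeasure ?D {x<..} = (\<integral>\<^sup>+ s. 0 \<partial>?M)"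
        unfolding D using 3 mass_mono[OF u, of _ 1]
        by (intro nn_integral_cong) (force simp: V_def split: split_indicator)
      moreover have "{0..V} \<inter> {x<..} = {}" using 3 by auto
      ultimately show ?thesis unfolding L by simp
    qed
  qed
  then show "emeasure ?D {x<..} < \<infinity>" for x
    unfolding L by (simp add: emeasure_mono[THEN order.strict_trans1, of _ "{0..V}"] emeasure_lborel_Icc_eq)
qed auto

text \<open>With \<open>u\<close> moved into the measure as a density, the integrand depends on s
  only through \<open>mass u s\<close>, and \<open>distr_mass\<close> identifies the image measure
  with Lebesgue measure on [0, mass u 1].\<close>

lemma
  assumes u: "profile u" and h: "continuous_on UNIV h"
  shows integrable_mass_compose: "integrable (lebesgue_on {0..1}) (\<lambda>s. u s * h (mass u s))"
    and integral_mass_compose: "(LINT s|lebesgue_on {0..1}. u s * h (mass u s)) = integral {0..mass u 1} h"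
proof -
  note [measurable] = profile_measurable[OF u order_refl] mass_measurable[OF u]
  have hm [measurable]: "h \<in> borel_measurable borel" using h by (rule borel_measurable_continuous_onI)
  have "compact (h ` {0..1})"
    by (intro compact_continuous_image continuous_on_subset[OF h]) auto
  then obtain B where B: "\<And>y. y \<in> {0..1} \<Longrightarrow> \<bar>h y\<bar> \<le> B"
    using compact_imp_bounded bounded_real by (metis imageI)
  show "integrable (lebesgue_on {0..1}) (\<lambda>s. u s * h (mass u s))"
  proof (rule integrable_bounded_unit)
    fix s :: real assume s: "s \<in> {0..1}"
    have "\<bar>u s\<bar> * \<bar>h (mass u s)\<bar> \<le> 1 * B"
      using mass_bounds[OF u s] profile_range[OF u s] s by (intro mult_mono B) auto
    then show "\<bar>u s * h (mass u s)\<bar> \<le> B" by (simp add: abs_mult)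
  qed measurable
  have "(LINT s|lebesgue_on {0..1}. u s * h (mass u s)) = (LINT s|density (lebesgue_on {0..1}) u. h (mass u s))"
    using profile_range[OF u] by (subst integral_density) auto
  also have "\<dots> = (LINT y|distr (density (lebesgue_on {0..1}) u) borel (mass u). h y)"
    by (rule integral_distr[symmetric]) measurable
  also have "\<dots> = (LINT y|density lborel (\<lambda>y. ennreal (indicator {0..mass u 1} y)). h y)"
    unfolding distr_mass[OF u] by (simp add: ennreal_indicator)
  also have "\<dots> = (LINT y|lborel. indicator {0..mass u 1} y *\<^sub>R h y)"
    by (subst integral_density) auto
  also have "\<dots> = integral {0..mass u 1} h"
    unfolding set_lebesgue_integral_def[symmetric]
    by (intro set_borel_integral_eq_integral borel_integrable_atLeastAtMost' continuous_on_subset[OF h]) auto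
  finally show "(LINT s|lebesgue_on {0..1}. u s * h (mass u s)) = integral {0..mass u 1} h" .
qed

text \<open>The point 0 is null for the image measure of \<open>distr_mass\<close>, so the zero set
  of the mass is null for the measure with density \<open>u\<close>. This excludes the default value
  of division by sqrt 0.\<close>

lemma AE_mass_pos:
  assumes u: "profile u"
  shows "AE s in lebesgue_on {0..1}. u s = 0 \<or> 0 < mass u s"
proof -
  note [measurable] = profile_measurable[OF u order_refl] mass_measurable[OF u]
  have "AE y in density lborel (indicator {0..mass u 1}). y \<noteq> 0"
    using AE_lborel_singleton[of "0::real"] by (subst AE_density) auto
  then have "AE s in density (lebesgue_on {0..1}) u. mass u s \<noteq> 0"
    unfolding distr_mass[OF u, symmetric] by (subst (asm) AE_distr_iff) auto
  then have "AE s in lebesgue_on {0..1}. 0 < u s \<longrightarrow> mass u s \<noteq> 0"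
    by (subst (asm) AE_density) auto
  then show ?thesis
    using AE_space by eventually_elim (use mass_bounds[OF u] profile_range[OF u] in fastforce)
qed

subsection \<open>Extremal profiles\<close>

text \<open>The condition on \<open>u\<close> is the differential equation V' = 1 / F(V), V(0) = 0
  for its mass V. Separation of variables solves it: V is the inverse of the antiderivative of
  \<open>F\<close>, and the normalisation of \<open>F\<close> makes V reach \<open>m\<close> exactly
  at s = 1.\<close>

lemma profile_of_inverse_speed:
  fixes F :: "real \<Rightarrow> real"
  assumes F: "continuous_on UNIV F" and F1: "\<And>x. 1 \<le> F x"
    and m: "0 < m" and Fm: "integral {0..m} F = 1"
  obtains u where "profile u" "\<And>s. s \<in> {0..1} \<Longrightarrow> u s = 1 / F (mass u s)" "mass u 1 = m"
proof -
  have cont: "continuous_on S F" for S using F by (rule continuous_on_subset) auto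
  have int: "F integrable_on {a..b}" for a b by (intro integrable_continuous_interval cont)
  \<comment> \<open>The base point -2 leaves room on both sides of [0, m], so that \<open>G\<close>
    has two-sided derivatives there and its inverse is differentiable also at the end points 0 and
    1.\<close>
  define G where "G x = integral {-2..x} F - integral {-2..0} F" for x
  have der: "DERIV G x :> F x" if "-2 < x" "x < m + 2" for x
  proof -
    have "((\<lambda>x. integral {-2..x} F) has_real_derivative F x) (at x within {-2..m + 2})"
      using that by (intro integral_has_real_derivative cont) auto
    then have "DERIV (\<lambda>x. integral {-2..x} F) x :> F x"
      using that by (simp add: at_within_Icc_at)
    then show ?thesis unfolding G_def by (auto intro!: derivative_eq_intros)
  qed
  have G0: "G 0 = 0" by (simp add: G_def)
  have Gm: "G m = 1"
    using Henstock_Kurzweil_Integration.integral_combine[of "-2" 0 m F, OF _ _ int] m Fm by (simp add: G_def)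
  have less: "G x < G y" if "-2 < x" "x < y" "y < m + 2" for x y
  proof (rule DERIV_pos_imp_increasing[OF that(2)])
    fix z assume "x \<le> z" "z \<le> y"
    then show "\<exists>D. DERIV G z :> D \<and> 0 < D"
      using that der[of z] F1[of z] by (intro exI[of _ "F z"]) auto
  qed
  have inj: "inj_on G {-1..m + 1}"
    using less by (intro linorder_inj_onI) force+
  define V where "V = the_inv_into {-1..m + 1} G"
  have VG: "V (G x) = x" if "x \<in> {-1..m + 1}" for x
    unfolding V_def using that by (rule the_inv_into_f_f[OF inj])
  have isG: "isCont G x" if "-1 \<le> x" "x \<le> m + 1" for x
    using that by (intro DERIV_isCont[OF der]) auto
  have surj: "\<exists>x. a \<le> x \<and> x \<le> b \<and> G x = s" if "G a \<le> s" "s \<le> G b" "-1 \<le> a" "a \<le> b" "b \<le> m + 1" for a b s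
    using that isG by (intro IVT) auto
  have GV: "G (V s) = s" if "G (-1) < s" "s < G (m + 1)" for s
    using surj[of "-1" s "m + 1"] that m VG by force
  have lo: "G (-1) < 0" and hi: "1 < G (m + 1)"
    using less[of "-1" 0] less[of m "m + 1"] G0 Gm m by auto
  have Vr: "V s \<in> {0..m}" if "s \<in> {0..1}" for s
    using surj[of 0 s m] that m VG G0 Gm by force
  have V0: "V 0 = 0" and V1: "V 1 = m" using VG[of 0] VG[of m] G0 Gm m by auto
  have contV: "isCont V s" if "s \<in> {0..1}" for s
  proof -
    have "isCont V (G (V s))"
      by (rule isCont_inverse_function2[where f = G and a = "-1" and b = "m + 1" and x = "V s"])
        (use Vr[OF that] VG isG in auto)
    then show ?thesis using GV[of s] lo hi that by simp
  qed
  have derV: "DERIV V s :> inverse (F (V s))" if "s \<in> {0..1}" for s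
  proof (rule DERIV_inverse_function)
    show "DERIV G (V s) :> F (V s)" using Vr[OF that] by (intro der) auto
    show "F (V s) \<noteq> 0" using F1[of "V s"] by auto
    show "G (-1) < s" "s < G (m + 1)" using lo hi that by auto
  qed (use that contV GV in auto)
  define u where "u s = 1 / F (V s)" for s
  have "continuous_on {0..1} V"
    using contV by (intro continuous_at_imp_continuous_on) auto
  then have "continuous_on {0..1} (F \<circ> V)"
    by (intro continuous_on_compose cont)
  moreover have nz: "F x \<noteq> 0" for x using F1[of x] by auto
  ultimately have "continuous_on {0..1} u"
    unfolding u_def by (intro continuous_intros) (auto simp: comp_def)
  then have "u \<in> borel_measurable (lebesgue_on {0..1})"
    by (intro continuous_imp_measurable_on_sets_lebesgue) auto
  moreover have "0 \<le> u s" "u s \<le> 1" for s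
    using F1[of "V s"] by (auto simp: u_def)
  ultimately have prof: "profile u" by (auto simp: profile_def)
  have mass: "mass u s = V s" if "s \<in> {0..1}" for s
  proof -
    have "(u has_integral V s - V 0) {0..s}"
    proof (rule fundamental_theorem_of_calculus)
      fix x assume "x \<in> {0..s}"
      then have "DERIV V x :> u x" using derV[of x] that by (simp add: u_def inverse_eq_divide)
      then show "(V has_vector_derivative u x) (at x within {0..s})"
        by (auto simp: has_real_derivative_iff_has_vector_derivative intro: has_vector_derivative_at_within)
    qed (use that in auto)
    then show ?thesis using mass_eq_integral(1)[OF prof, of s] V0 that by (simp add: integral_unique)
  qed
  show thesis
    by (rule that[of u]) (use prof mass V1 in \<open>auto simp: u_def\<close>)
qed

section \<open>Convex duality for the rescaled problem\<close>

lemma Young_exp: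
  fixes K w :: real
  assumes "0 < K"
  shows "K - K * ln K \<le> exp w - K * w"
proof -
  \<comment> \<open>This is the tangent inequality of exp at \<open>ln K\<close>, with equality for
    \<open>w = ln K\<close>.\<close>
  have "K * (1 + (w - ln K)) \<le> K * exp (w - ln K)"
    using assms exp_ge_add_one_self by (intro mult_left_mono) auto
  also have "\<dots> = exp w" using assms by (simp add: exp_diff)
  finally show ?thesis by (simp add: algebra_simps)
qed

lemma integral_scale_Icc:
  fixes f :: "real \<Rightarrow> real"
  assumes "0 < V"
  shows "integral {0..V} (\<lambda>y. f (y / V)) = V * integral {0..1} f"
proof -
  have "integral {0..V} (\<lambda>y. f (y / V)) = integral ((\<lambda>x. V * x) ` {0..1}) (\<lambda>y. f (y / V))"
    using assms by simp
  then show ?thesis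
    using integral_stretch_real[of "1 / V" 0 1 f] assms by (simp add: mult.commute[of _ V])
qed

lemma I_fun_integrable:
  assumes u: "profile u"
  shows "integrable (lebesgue_on {0..1}) (\<lambda>s. u s * ln (u s))"
proof (rule integrable_bounded_unit)
  show "(\<lambda>s. u s * ln (u s)) \<in> borel_measurable (lebesgue_on {0..1})"
    using profile_measurable[OF u order_refl] by measurable
  fix s :: real assume s: "s \<in> {0..1}"
  show "\<bar>u s * ln (u s)\<bar> \<le> 1"
  proof (cases "u s = 0")
    case False
    with profile_range[OF u s] have *: "0 < u s" "u s \<le> 1" by auto
    have "- (u s * ln (u s)) \<le> sqrt (u s)" using xlnx_bound * by blast
    also have "\<dots> \<le> 1" using * by simp
    finally show ?thesis using * by (simp add: abs_mult)
  qed auto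
qed

lemma mass_pos:
  assumes u: "profile u" and "I_fun u \<noteq> 0"
  shows "0 < mass u 1"
proof (rule ccontr)
  assume 0: "\<not> 0 < mass u 1"
  have "AE s in lebesgue_on {0..1}. u s * ln (u s) = 0"
    using AE_mass_pos[OF u] AE_space
    by eventually_elim (use 0 mass_mono[OF u, of _ 1] in fastforce)
  then have "(LINT s|lebesgue_on {0..1}. u s * ln (u s)) = 0"
    by (rule integral_eq_zero_AE)
  then have "I_fun u = 0" by (simp add: I_fun_def)
  with assms show False by simp
qed

lemma J_fun_mass: "J_fun u = - (LINT s|lebesgue_on {0..1}. u s * ln (u s) / sqrt (mass u s))"
  by (simp add: J_fun_def mass_def)

lemma J_integrable:
  assumes "profile u"
  shows "integrable (lebesgue_on {0..1}) (\<lambda>s. u s * ln (u s) / sqrt (mass u s))"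
  using integrable_J_fun[OF assms] by (simp add: mass_def)

text \<open>The summand 1 is the constraint term: with \<open>w = - ln u\<close> the product
  \<open>u * exp w\<close> equals 1 wherever \<open>u\<close> is positive. The multiplier
  \<open>p\<close> will be \<open>l * sqrt V\<close>.\<close>

lemma Lagrangian:
  assumes u: "profile u"
  shows "integrable (lebesgue_on {0..1}) (\<lambda>s. - p * (u s * ln (u s) / sqrt (mass u s)) + c * (u s * ln (u s)) + 1)"
      (is "integrable ?M _")
    and "(LINT s|lebesgue_on {0..1}. - p * (u s * ln (u s) / sqrt (mass u s)) + c * (u s * ln (u s)) + 1)
      = p * J_fun u - c * I_fun u + 1"
proof -
  have 1: "integrable ?M (\<lambda>s. - p * (u s * ln (u s) / sqrt (mass u s)))"
    by (intro integrable_mult_right J_integrable u)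
  have 2: "integrable ?M (\<lambda>s. c * (u s * ln (u s)))"
    by (intro integrable_mult_right I_fun_integrable u)
  have 3: "integrable ?M (\<lambda>_. 1 :: real)"
    by (intro integrable_bounded_unit[where B = 1]) auto
  show "integrable ?M (\<lambda>s. - p * (u s * ln (u s) / sqrt (mass u s)) + c * (u s * ln (u s)) + 1)"
    by (intro Bochner_Integration.integrable_add 1 2 3)
  have "measure ?M {0..1} = 1" by (simp add: measure_restrict_space)
  then show "(LINT s|?M. - p * (u s * ln (u s) / sqrt (mass u s)) + c * (u s * ln (u s)) + 1)
      = p * J_fun u - c * I_fun u + 1"
    using Bochner_Integration.integral_add[OF Bochner_Integration.integrable_add[OF 1 2] 3]
      Bochner_Integration.integral_add[OF 1 2]
    by (simp only: integral_mult_right_zero J_fun_mass I_fun_def) simp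
qed

text \<open>For positive y the three conditions on values say
  \<open>K y = max 1 (c - l / sqrt y)\<close>. Continuity is asked on the whole line so that
  \<open>integral_mass_compose\<close> applies; this fixes a finite value at 0, where the formula
  has a pole.\<close>

locale extremal =
  fixes K :: "real \<Rightarrow> real" and c l :: real
  assumes cont: "continuous_on UNIV K" and ge_1: "\<And>y. 1 \<le> K y"
    and ge: "\<And>y. 0 < y \<Longrightarrow> c - l / sqrt y \<le> K y"
    and eq: "\<And>y. 0 < y \<Longrightarrow> K y = 1 \<or> K y = c - l / sqrt y"
    and l: "0 < l"
begin

text \<open>The extremal profile will have total mass \<open>1 / T\<close> and \<open>I_fun\<close>
  equal to \<open>A / T\<close>; \<open>P\<close> is the dual bound per unit of mass.\<close>

definition T where "T = integral {0..1} K"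
definition A where "A = integral {0..1} (\<lambda>y. ln (K y))"
definition P where "P = integral {0..1} (\<lambda>y. K y - K y * ln (K y))"

lemma K_pos: "0 < K y" using ge_1[of y] by auto

lemma cont_ln: "continuous_on S (\<lambda>y. ln (K y))"
  using K_pos by (intro continuous_intros continuous_on_subset[OF cont]) (auto simp: less_le)

lemma T_ge_1: "1 \<le> T"
proof -
  have "integral {0..1::real} (\<lambda>_. 1) \<le> integral {0..1} K"
    by (intro integral_le integrable_continuous_interval continuous_on_subset[OF cont] ge_1) auto
  then show ?thesis by (simp add: T_def)
qed

lemma cont_compose:
  assumes "V \<noteq> 0"
  shows "continuous_on S (\<lambda>y. K (y / V))" "continuous_on S (\<lambda>y. ln (K (y / V)))"
    "continuous_on S (\<lambda>y. K (y / V) - K (y / V) * ln (K (y / V)))"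
proof -
  show 1: "continuous_on S (\<lambda>y. K (y / V))" for S
    using assms by (intro continuous_on_compose2[OF cont] continuous_intros) auto
  show 2: "continuous_on S (\<lambda>y. ln (K (y / V)))" for S
    using assms by (intro continuous_on_compose2[OF cont_ln[of UNIV]] continuous_intros) auto
  show "continuous_on S (\<lambda>y. K (y / V) - K (y / V) * ln (K (y / V)))"
    by (intro continuous_intros 1 2)
qed

lemma integral_P:
  assumes u: "profile u" and V: "V = mass u 1" "0 < V"
  shows "(LINT s|lebesgue_on {0..1}. u s * (K (mass u s / V) - K (mass u s / V) * ln (K (mass u s / V)))) = V * P"
  using V integral_scale_Icc[of V "\<lambda>y. K y - K y * ln (K y)"]
  by (subst integral_mass_compose[OF u cont_compose(3)]) (auto simp: P_def)

lemma lower_bound: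
  assumes u: "profile u" and V: "V = mass u 1" "0 < V"
  shows "V * P \<le> l * sqrt V * J_fun u - c * I_fun u + 1"
proof -
  let ?h = "\<lambda>y. K (y / V) - K (y / V) * ln (K (y / V))"
  have pt: "u s * ?h (mass u s) \<le> - (l * sqrt V) * (u s * ln (u s) / sqrt (mass u s)) + c * (u s * ln (u s)) + 1"
    if s: "s \<in> {0..1}" "u s = 0 \<or> 0 < mass u s" for s
  proof (cases "u s = 0")
    case False
    define y w where "y = mass u s / V" and "w = - ln (u s)"
    have us: "0 < u s" "u s \<le> 1" and y: "0 < y"
      using s False profile_range[OF u s(1)] V by (auto simp: y_def)
    have w: "0 \<le> w" using us by (simp add: w_def)
    have "?h (mass u s) \<le> exp w - K y * w"
      unfolding y_def[symmetric] by (rule Young_exp[OF K_pos])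
    \<comment> \<open>Lowering the slope from \<open>K y\<close> is allowed because \<open>w\<close>
      is nonnegative, which is where \<open>u s \<le> 1\<close> enters.\<close>
    also have "\<dots> \<le> exp w - (c - l / sqrt y) * w"
      using mult_right_mono[OF ge[OF y] w] by simp
    finally have "u s * ?h (mass u s) \<le> u s * (exp w - (c - l / sqrt y) * w)"
      using us by (intro mult_left_mono) auto
    also have "exp w = 1 / u s" using us by (simp add: w_def exp_minus inverse_eq_divide)
    \<comment> \<open>The rescaling y = mass / V is the source of the factor \<open>sqrt V\<close>
      in front of \<open>J_fun\<close>.\<close>
    also have "l / sqrt y = l * sqrt V / sqrt (mass u s)"
      by (simp add: y_def real_sqrt_divide)
    finally show ?thesis using us by (simp add: w_def algebra_simps)
  qed simp
  have "(LINT s|lebesgue_on {0..1}. u s * ?h (mass u s))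
     \<le> (LINT s|lebesgue_on {0..1}. - (l * sqrt V) * (u s * ln (u s) / sqrt (mass u s)) + c * (u s * ln (u s)) + 1)"
  proof (rule integral_mono_AE)
    show "AE s in lebesgue_on {0..1}. u s * ?h (mass u s)
        \<le> - (l * sqrt V) * (u s * ln (u s) / sqrt (mass u s)) + c * (u s * ln (u s)) + 1"
      using AE_mass_pos[OF u] AE_space by eventually_elim (use pt in auto)
    show "integrable (lebesgue_on {0..1}) (\<lambda>s. u s * ?h (mass u s))"
      using V by (intro integrable_mass_compose u cont_compose) auto
  qed (rule Lagrangian[OF u])
  then show ?thesis
    using Lagrangian[OF u] integral_P[OF u V] by simp
qed

text \<open>For the extremal profile the dual bound is an equality and gives
  \<open>l * sqrt m * J = 2 * m * P\<close>. For a competitor with the same lift but mass V it gives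
  \<open>l * sqrt V * J \<ge> (V + m) * P\<close>. The arithmetic-geometric inequality then removes
  the unknown V.\<close>

lemma optimal_profile:
  assumes K_le: "\<And>y. y \<in> {0..1} \<Longrightarrow> K y \<le> exp 1"
    and A: "0 < A" and ident: "c * A - T = P"
  shows "\<exists>u. profile u \<and> I_fun u = A / T \<and> (\<forall>v. profile v \<and> I_fun v = A / T \<longrightarrow> J_fun u \<le> J_fun v)"
proof -
  define m where "m = 1 / T"
  have m: "0 < m" using T_ge_1 by (simp add: m_def)
  \<comment> \<open>The sign of \<open>P\<close> is what allows multiplying the arithmetic-geometric
    inequality by it; the integrand K (1 - ln K) is nonnegative since K is at most e.\<close>
  have P: "0 \<le> P"
    unfolding P_def
  proof (rule integral_nonneg)
    fix y :: real assume "y \<in> {0..1}"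
    then have "ln (K y) \<le> ln (exp 1)" using K_le K_pos by (subst ln_le_cancel_iff) auto
    then have "K y * ln (K y) \<le> K y * 1" using K_pos[of y] by (intro mult_left_mono) auto
    then show "0 \<le> K y - K y * ln (K y)" by simp
  qed (use cont_compose(3)[of 1] in \<open>auto intro: integrable_continuous_interval\<close>)
  have "integral {0..m} (\<lambda>x. K (x / m)) = 1"
    using m integral_scale_Icc[OF m, of K] by (simp add: T_def m_def)
  then obtain u where u: "profile u" and uK: "\<And>s. s \<in> {0..1} \<Longrightarrow> u s = 1 / K (mass u s / m)"
    and um: "mass u 1 = m"
    using profile_of_inverse_speed[of "\<lambda>x. K (x / m)" m] m ge_1 cont_compose(1)[of m UNIV] by auto
  have I: "I_fun u = m * A"
  proof -
    have "I_fun u = (LINT s|lebesgue_on {0..1}. u s * ln (K (mass u s / m)))"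
      unfolding I_fun_def Bochner_Integration.integral_minus[symmetric]
      using K_pos by (intro Bochner_Integration.integral_cong) (simp_all add: uK ln_div less_imp_neq)
    also have "\<dots> = m * A"
      using m integral_scale_Icc[OF m, of "\<lambda>y. ln (K y)"]
      by (subst integral_mass_compose[OF u cont_compose(2)]) (auto simp: um A_def)
    finally show ?thesis .
  qed
  have J: "l * sqrt m * J_fun u = 2 * m * P"
  proof -
    have "m * P = (LINT s|lebesgue_on {0..1}.
        - (l * sqrt m) * (u s * ln (u s) / sqrt (mass u s)) + c * (u s * ln (u s)) + 1)"
      unfolding integral_P[OF u um[symmetric] m, symmetric]
    proof (rule integral_cong_AE)
      show "AE s in lebesgue_on {0..1}.
         u s * (K (mass u s / m) - K (mass u s / m) * ln (K (mass u s / m))) =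
         - (l * sqrt m) * (u s * ln (u s) / sqrt (mass u s)) + c * (u s * ln (u s)) + 1"
        using AE_mass_pos[OF u] AE_space
      proof eventually_elim
        fix s assume "u s = 0 \<or> 0 < mass u s" and s: "s \<in> space (lebesgue_on {0..1})"
        define k y where "k = K (mass u s / m)" and "y = mass u s / m"
        have k_y: "k = K y" by (simp add: k_def y_def)
        have us: "u s = 1 / k" using uK s by (simp add: k_def)
        have k: "0 < k" using K_pos by (simp add: k_def)
        have lnu: "ln (u s) = - ln k" using k by (simp add: us ln_div)
        have y: "0 < y" using \<open>u s = 0 \<or> 0 < mass u s\<close> us k m by (auto simp: y_def)
        have "l * sqrt m * (u s * ln (u s) / sqrt (mass u s)) = l * sqrt m / sqrt (mass u s) * (u s * ln (u s))"
          by simp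
        also have "l * sqrt m / sqrt (mass u s) = l / sqrt y"
          by (simp add: y_def real_sqrt_divide)
        finally have "- (l * sqrt m) * (u s * ln (u s) / sqrt (mass u s)) + c * (u s * ln (u s)) + 1
            = 1 - (l / sqrt y * (u s * ln (u s)) - c * (u s * ln (u s)))"
          by (simp only: mult_minus_left)
        also have "\<dots> = 1 - (c - l / sqrt y) * (u s * ln k)"
          unfolding lnu by (simp only: left_diff_distrib mult_minus_right)
        \<comment> \<open>Complementary slackness: either \<open>k\<close> equals the multiplier
          \<open>c - l / sqrt y\<close>, or \<open>k = 1\<close> and
          \<open>ln k = 0\<close>.\<close>
        also have "\<dots> = 1 - k * (u s * ln k)" using eq[OF y] by (auto simp: k_y)
        also have "\<dots> = u s * (k - k * ln k)" using k by (simp add: us field_simps)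
        finally show "u s * (K (mass u s / m) - K (mass u s / m) * ln (K (mass u s / m))) =
         - (l * sqrt m) * (u s * ln (u s) / sqrt (mass u s)) + c * (u s * ln (u s)) + 1"
          by (simp add: k_def)
      qed
    qed (use m in \<open>intro borel_measurable_integrable integrable_mass_compose u cont_compose Lagrangian(1); simp\<close>)+
    also have "\<dots> = l * sqrt m * J_fun u - c * (m * A) + 1"
      using Lagrangian(2)[OF u] I by simp
    also have "1 = m * T" using T_ge_1 by (simp add: m_def)
    finally have "l * sqrt m * J_fun u = m * (P + (c * A - T))" by (simp add: algebra_simps)
    then show ?thesis unfolding ident by simp
  qed
  have "J_fun u \<le> J_fun v" if v: "profile v" "I_fun v = A / T" for v
  proof -
    define V where "V = mass v 1"
    have V: "0 < V" unfolding V_def using v A T_ge_1 by (intro mass_pos) auto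
    \<comment> \<open>Multiplying the identity \<open>c * A - T = P\<close> by
      \<open>m = 1 / T\<close> turns the constant term of the bound into
      \<open>- m * P\<close>.\<close>
    have "1 - c * (m * A) = - m * P" using ident T_ge_1 by (simp add: m_def field_simps)
    then have "(V + m) * P \<le> l * sqrt V * J_fun v"
      using lower_bound[OF v(1) V_def V] v(2) by (simp add: m_def algebra_simps)
    moreover have "2 * sqrt V * sqrt m \<le> V + m"
      using V m sum_squares_bound[of "sqrt V" "sqrt m"] by simp
    ultimately have "(2 * sqrt V * sqrt m) * P \<le> l * sqrt V * J_fun v"
      using P by (meson mult_right_mono order_trans)
    then have "sqrt V * (2 * sqrt m * P) \<le> sqrt V * (l * J_fun v)" by (simp add: mult_ac)
    then have "2 * sqrt m * P \<le> l * J_fun v" using V by simp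
    then have "sqrt m * (2 * sqrt m * P) \<le> sqrt m * (l * J_fun v)" using m by (intro mult_left_mono) auto
    also have "sqrt m * (2 * sqrt m * P) = sqrt m * (l * J_fun u)"
      using J m by (simp add: mult_ac flip: mult.assoc[of "sqrt m" "sqrt m"])
    finally show ?thesis using m l by simp
  qed
  then show ?thesis using u I by (intro exI[of _ u]) (auto simp: m_def)
qed

end

subsection \<open>A one-parameter family of extremals\<close>

text \<open>For positive b this is the value r of \<open>sqrt y\<close> that solves e (1 + b - b /
  r) = 1, where the truncation at 1 begins.\<close>

definition edge :: "real \<Rightarrow> real" where
  "edge b = b / (b + (1 - exp (- 1)))"

text \<open>The multipliers are c = e (1 + b) and l = e b, so c - l = e and the value at y = 1 is e.
  For b > 0, truncating the denominator amounts to taking the maximum with 1 at positive y and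
  removes the pole at 0; b = 0 gives the constant e.\<close>

definition inv_speed :: "real \<Rightarrow> real \<Rightarrow> real" where
  "inv_speed b y = exp 1 * (1 + b - b / max (sqrt y) (edge b))"

lemma edge_bounds:
  assumes "0 \<le> b"
  shows "0 \<le> edge b" "edge b < 1"
proof -
  have "exp (- 1) < (1 :: real)" by simp
  then have "0 < b + (1 - exp (- 1))" using assms by linarith
  then show "0 \<le> edge b" "edge b < 1"
    unfolding edge_def using assms by (simp_all add: divide_less_eq)
qed

lemma edge_pos: "0 < b \<Longrightarrow> 0 < edge b"
  by (auto simp: edge_def intro!: divide_pos_pos add_pos_pos)

lemma b_div_edge: "0 < b \<Longrightarrow> b / edge b = b + (1 - exp (- 1))"
  by (simp add: edge_def)

lemma inv_speed_0 [simp]: "inv_speed 0 y = exp 1"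
  by (simp add: inv_speed_def)

lemma inv_speed_edge:
  assumes "0 < b" "sqrt y \<le> edge b"
  shows "inv_speed b y = 1"
proof -
  have "inv_speed b y = exp 1 * exp (- 1)"
    using assms b_div_edge[of b] by (simp add: inv_speed_def max_def)
  then show ?thesis by (simp flip: exp_add)
qed

lemma inv_speed_ge_1:
  assumes "0 \<le> b"
  shows "1 \<le> inv_speed b y"
proof (cases "b = 0")
  case False
  then have b: "0 < b" using assms by simp
  have "b / max (sqrt y) (edge b) \<le> b / edge b"
    using b edge_pos[OF b] by (intro frac_le) auto
  then have "exp 1 * exp (- 1) \<le> inv_speed b y"
    unfolding inv_speed_def b_div_edge[OF b] by (intro mult_left_mono) auto
  then show ?thesis by (simp flip: exp_add)
qed simp

lemma inv_speed_le_exp_1: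
  assumes "0 \<le> b" "y \<in> {0..1}"
  shows "inv_speed b y \<le> exp 1"
proof (cases "b = 0")
  case False
  then have b: "0 < b" using assms by simp
  have "b / 1 \<le> b / max (sqrt y) (edge b)"
    using assms b edge_pos[OF b] edge_bounds[of b] by (intro frac_le) auto
  then have "inv_speed b y \<le> exp 1 * 1"
    unfolding inv_speed_def by (intro mult_left_mono) auto
  then show ?thesis by simp
qed simp

lemma continuous_on_inv_speed:
  assumes "0 \<le> b"
  shows "continuous_on S (inv_speed b)"
proof (cases "b = 0")
  case True
  then show ?thesis by (simp add: continuous_on_cong[OF refl, of _ "inv_speed 0" "\<lambda>_. exp 1"])
next
  case False
  then have "0 < max (sqrt y) (edge b)" for y using edge_pos[of b] assms by auto
  then show ?thesis unfolding inv_speed_def by (intro continuous_intros) (auto simp: less_le)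
qed

lemma extremal_inv_speed:
  assumes b: "0 < b"
  shows "extremal (inv_speed b) (exp 1 * (1 + b)) (exp 1 * b)"
proof
  show "continuous_on UNIV (inv_speed b)" using b by (intro continuous_on_inv_speed) auto
  show "1 \<le> inv_speed b y" for y using b by (intro inv_speed_ge_1) auto
  fix y :: real assume y: "0 < y"
  have eq: "inv_speed b y = exp 1 * (1 + b) - exp 1 * b / max (sqrt y) (edge b)"
    by (simp add: inv_speed_def algebra_simps)
  have "exp 1 * b / max (sqrt y) (edge b) \<le> exp 1 * b / sqrt y"
    using y b by (intro frac_le) auto
  then show "exp 1 * (1 + b) - exp 1 * b / sqrt y \<le> inv_speed b y" by (simp add: eq)
  show "inv_speed b y = 1 \<or> inv_speed b y = exp 1 * (1 + b) - exp 1 * b / sqrt y"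
    using inv_speed_edge[OF b, of y] eq by (cases "sqrt y \<le> edge b") (auto simp: max_def)
qed (use b in simp)

text \<open>Above the edge c - K = l / sqrt y. Writing the derivative through K itself eliminates l,
  which is the form needed to differentiate \<open>H\<close> in the next lemma.\<close>

lemma inv_speed_deriv:
  assumes b: "0 < b" and y: "edge b < sqrt y"
  shows "(inv_speed b has_real_derivative (exp 1 * (1 + b) - inv_speed b y) / (2 * y)) (at y)"
proof -
  have y0: "0 < y" using edge_pos[OF b] y by (metis less_trans real_sqrt_gt_0_iff)
  have "((\<lambda>y. exp 1 * (1 + b - b / sqrt y)) has_real_derivative exp 1 * (b * (inverse (sqrt y) / 2) / (sqrt y * sqrt y))) (at y)"
    using y0 by (auto intro!: derivative_eq_intros)
  then have "((\<lambda>y. exp 1 * (1 + b - b / sqrt y)) has_real_derivative (exp 1 * (1 + b) - inv_speed b y) / (2 * y)) (at y)"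
    using y0 y by (simp add: inv_speed_def max_def field_simps)
  moreover have "open {x. edge b < sqrt x}" by (intro open_Collect_less continuous_intros)
  then have "\<forall>\<^sub>F x in nhds y. x \<in> {x. edge b < sqrt x}"
    using y by (intro eventually_nhds_in_open) auto
  then have "\<forall>\<^sub>F x in nhds y. exp 1 * (1 + b - b / sqrt x) = inv_speed b x"
    by eventually_elim (simp add: inv_speed_def max_def)
  from DERIV_cong_ev[OF refl this refl] calculation show ?thesis by simp
qed

text \<open>The integrand of \<open>c * A - T - P\<close> has the antiderivative \<open>H\<close>,
  because 2 y K' = c - K above the edge and K = 1 below it.\<close>

lemma inv_speed_identity:
  assumes b: "0 < b"
  shows "exp 1 * (1 + b) * extremal.A (inv_speed b) - extremal.T (inv_speed b) = extremal.P (inv_speed b)"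
proof -
  interpret extremal "inv_speed b" "exp 1 * (1 + b)" "exp 1 * b" by (rule extremal_inv_speed[OF b])
  define c where "c = exp 1 * (1 + b)"
  define f where "f y = c * ln (inv_speed b y) - 2 * inv_speed b y + inv_speed b y * ln (inv_speed b y)" for y
  define H where "H y = 2 * y * (inv_speed b y * ln (inv_speed b y) - inv_speed b y)" for y
  have KP: "0 < inv_speed b y" for y by (rule K_pos)
  have "(f has_integral (H 1 - H 0)) {0..1}"
  \<comment> \<open>The kink at sqrt y = edge b is the only exceptional point.\<close>
  proof (rule fundamental_theorem_of_calculus_interior_strong[of "{(edge b)\<^sup>2}"])
    show "continuous_on {0..1} H"
      unfolding H_def using b by (intro continuous_intros continuous_on_inv_speed cont_ln) auto
    fix y assume "y \<in> {0<..<1} - {(edge b)\<^sup>2}"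
    then have y: "0 < y" "sqrt y \<noteq> edge b" by (auto dest: sym)
    show "(H has_vector_derivative f y) (at y)"
    proof (cases "sqrt y < edge b")
      case True
      have "((\<lambda>y. - 2 * y) has_real_derivative - 2) (at y)" by (auto intro!: derivative_eq_intros)
      moreover have "open {x. sqrt x < edge b}" by (intro open_Collect_less continuous_intros)
      then have "\<forall>\<^sub>F x in nhds y. x \<in> {x. sqrt x < edge b}"
        using True by (intro eventually_nhds_in_open) auto
      then have "\<forall>\<^sub>F x in nhds y. - 2 * x = H x"
        by eventually_elim (simp add: H_def inv_speed_edge[OF b])
      ultimately have "(H has_real_derivative - 2) (at y)"
        using DERIV_cong_ev[of y y "\<lambda>x. - 2 * x" H "- 2" "- 2"] by simp
      moreover have "f y = - 2" using True by (simp add: f_def inv_speed_edge[OF b])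
      ultimately show ?thesis by (simp add: has_real_derivative_iff_has_vector_derivative)
    next
      case False
      then have "edge b < sqrt y" using y by simp
      note D = inv_speed_deriv[OF b this]
      have "(H has_real_derivative f y) (at y)"
        unfolding H_def f_def using y KP[of y]
        by (auto intro!: derivative_eq_intros D simp: c_def field_simps)
      then show ?thesis by (simp add: has_real_derivative_iff_has_vector_derivative)
    qed
  qed auto
  \<comment> \<open>\<open>H\<close> vanishes at 0 through its factor y, and at 1 because K ln K = K
    for K = e.\<close>
  moreover have "inv_speed b 1 = exp 1"
    using edge_bounds[of b] b by (simp add: inv_speed_def max_def)
  ultimately have "integral {0..1} f = 0" by (simp add: H_def integral_unique)
  moreover have "integral {0..1} f = c * A - T - P"
  proof -
    have i: "inv_speed b integrable_on {0..1}" "(\<lambda>y. ln (inv_speed b y)) integrable_on {0..1}"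
      "(\<lambda>y. inv_speed b y - inv_speed b y * ln (inv_speed b y)) integrable_on {0..1}"
      using b by (auto intro!: integrable_continuous_interval continuous_intros continuous_on_inv_speed cont_ln)
    have "integral {0..1} f = integral {0..1} (\<lambda>y. c * ln (inv_speed b y) - inv_speed b y - (inv_speed b y - inv_speed b y * ln (inv_speed b y)))"
      by (intro integral_cong) (simp add: f_def)
    also have "\<dots> = integral {0..1} (\<lambda>y. c * ln (inv_speed b y) - inv_speed b y) - P"
      unfolding P_def by (intro integral_diff i integrable_diff integrable_on_mult_right)
    also have "integral {0..1} (\<lambda>y. c * ln (inv_speed b y) - inv_speed b y) = integral {0..1} (\<lambda>y. c * ln (inv_speed b y)) - T"
      unfolding T_def by (intro integral_diff i integrable_on_mult_right)
    finally show ?thesis by (simp add: A_def)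
  qed
  ultimately show ?thesis by (simp add: c_def)
qed

section \<open>Continuity and range of the lift along the family\<close>

lemma integral_inv_speed_limit:
  fixes g k :: "real \<Rightarrow> real"
  assumes g: "continuous_on {1..exp 1} g" and b: "\<And>n. 0 \<le> b n"
    and lim: "\<And>y. 0 < y \<Longrightarrow> y < 1 \<Longrightarrow> (\<lambda>n. inv_speed (b n) y) \<longlonglongrightarrow> k y"
  shows "(\<lambda>n. integral {0..1} (\<lambda>y. g (inv_speed (b n) y))) \<longlonglongrightarrow> integral {0..1} (\<lambda>y. g (k y))"
proof -
  have Kr: "inv_speed (b n) y \<in> {1..exp 1}" if "y \<in> {0..1}" for n y
    using that b inv_speed_ge_1 inv_speed_le_exp_1 by auto
  have "compact (g ` {1..exp 1})" by (intro compact_continuous_image g) auto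
  then obtain B where B: "\<And>x. x \<in> {1..exp 1} \<Longrightarrow> \<bar>g x\<bar> \<le> B"
    using compact_imp_bounded bounded_real by (metis imageI)
  have gK: "(\<lambda>y. g (inv_speed (b n) y)) integrable_on {0..1}" for n
    using Kr b by (intro integrable_continuous_interval continuous_on_compose2[OF g] continuous_on_inv_speed) auto
  \<comment> \<open>The open interval is essential: pointwise convergence can fail at y = 0 when b
    tends to 0, and at y = 1 when b tends to infinity, where the value stays e.\<close>
  have "(\<lambda>n. integral {0<..<1} (\<lambda>y. g (inv_speed (b n) y))) \<longlonglongrightarrow> integral {0<..<1} (\<lambda>y. g (k y))"
  proof (rule dominated_convergence)
    show "(\<lambda>y. g (inv_speed (b n) y)) integrable_on {0<..<1}" for n
      using gK by (simp add: integrable_on_open_interval_real)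
    show "(\<lambda>_. B) integrable_on {0<..<1::real}"
      by (simp add: integrable_on_open_interval_real integrable_continuous_interval)
    show "norm (g (inv_speed (b n) y)) \<le> B" if "y \<in> {0<..<1}" for n y
      using B[OF Kr] that by auto
    show "(\<lambda>n. g (inv_speed (b n) y)) \<longlonglongrightarrow> g (k y)" if "y \<in> {0<..<1}" for y
    proof (rule continuous_on_tendsto_compose[OF g lim])
      show "\<forall>\<^sub>F n in sequentially. inv_speed (b n) y \<in> {1..exp 1}" using Kr[of y] that by simp
      then show "k y \<in> {1..exp 1}"
        using that by (intro Lim_in_closed_set[OF _ _ _ lim]) auto
    qed (use that in auto)
  qed
  then show ?thesis by (simp add: integral_open_interval_real)
qed

text \<open>This is the quotient \<open>A / T\<close> of the locale, the value of
  \<open>I_fun\<close> at the extremal with parameter b; stated outside the locale it also covers b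
  = 0.\<close>

definition lift :: "real \<Rightarrow> real" where
  "lift b = integral {0..1} (\<lambda>y. ln (inv_speed b y)) / integral {0..1} (inv_speed b)"

lemma lift_limit:
  assumes b: "\<And>n. 0 \<le> b n"
    and lim: "\<And>y. 0 < y \<Longrightarrow> y < 1 \<Longrightarrow> (\<lambda>n. inv_speed (b n) y) \<longlonglongrightarrow> k y"
    and nz: "integral {0..1} k \<noteq> 0"
  shows "(\<lambda>n. lift (b n)) \<longlonglongrightarrow> integral {0..1} (\<lambda>y. ln (k y)) / integral {0..1} k"
proof -
  have "(\<lambda>n. integral {0..1} (\<lambda>y. ln (inv_speed (b n) y))) \<longlonglongrightarrow> integral {0..1} (\<lambda>y. ln (k y))"
    by (intro integral_inv_speed_limit b lim continuous_intros) auto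
  moreover have "(\<lambda>n. integral {0..1} (inv_speed (b n))) \<longlonglongrightarrow> integral {0..1} k"
    using integral_inv_speed_limit[of "\<lambda>x. x" b k, OF _ b lim] by simp
  ultimately show ?thesis unfolding lift_def by (intro tendsto_divide nz)
qed

lemma tendsto_inv_speed:
  fixes a :: real
  assumes "(b \<longlongrightarrow> a) F" "0 \<le> a" "0 < y"
  shows "((\<lambda>n. inv_speed (b n) y) \<longlongrightarrow> inv_speed a y) F"
proof -
  have "exp (- 1) < (1 :: real)" by simp
  then have "a + (1 - exp (- 1)) \<noteq> 0" using assms by linarith
  \<comment> \<open>At a = 0 the edge is 0, and only \<open>sqrt y\<close> keeps the denominator
    positive.\<close>
  moreover have "0 < max (sqrt y) (edge a)" using assms by (simp add: less_max_iff_disj)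
  ultimately show ?thesis
    unfolding inv_speed_def edge_def by (intro tendsto_intros assms) (auto simp: edge_def)
qed

lemma continuous_on_lift: "continuous_on {0..} lift"
proof (subst continuous_on_sequentially, intro allI ballI impI, elim conjE)
  fix b :: "nat \<Rightarrow> real" and a :: real
  assume a: "a \<in> {0..}" and b: "\<forall>n. b n \<in> {0..}" and lim: "b \<longlonglongrightarrow> a"
  have "integral {0..1::real} (\<lambda>_. 1) \<le> integral {0..1} (inv_speed a)"
    using a by (intro integral_le integrable_continuous_interval continuous_on_inv_speed inv_speed_ge_1) auto
  then show "(lift \<circ> b) \<longlonglongrightarrow> lift a"
    unfolding comp_def lift_def[of a] using a b lim by (intro lift_limit tendsto_inv_speed) auto
qed

text \<open>The edge tends to 1 as b grows, so at each fixed y < 1 the inverse speed is eventually 1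
  and its logarithm 0.\<close>

lemma lift_at_top: "(\<lambda>n. lift (real n)) \<longlonglongrightarrow> 0"
proof -
  have "(\<lambda>n. lift (real n)) \<longlonglongrightarrow> integral {0..1::real} (\<lambda>y. ln 1) / integral {0..1::real} (\<lambda>_. 1)"
  proof (rule lift_limit)
    fix y :: real assume y: "0 < y" "y < 1"
    \<comment> \<open>The threshold is the inequality sqrt y < edge n solved for n.\<close>
    have "\<forall>\<^sub>F n in sequentially. sqrt y * (1 - exp (- 1)) / (1 - sqrt y) < real n"
      using filterlim_real_sequentially by (simp add: filterlim_at_top_dense)
    with eventually_gt_at_top[of 0] have "\<forall>\<^sub>F n in sequentially. sqrt y < edge (real n)"
    proof eventually_elim
      fix n :: nat assume n: "0 < n" "sqrt y * (1 - exp (- 1)) / (1 - sqrt y) < real n"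
      have "exp (- 1) < (1 :: real)" by simp
      then have p: "0 < real n + (1 - exp (- 1))" using n(1) by linarith
      have "sqrt y * (1 - exp (- 1)) < real n * (1 - sqrt y)"
        using n(2) y by (simp add: pos_divide_less_eq)
      then have "sqrt y * (real n + (1 - exp (- 1))) < real n" by (simp add: algebra_simps)
      then show "sqrt y < edge (real n)" using p by (simp add: edge_def pos_less_divide_eq)
    qed
    with eventually_gt_at_top[of 0] have "\<forall>\<^sub>F n in sequentially. inv_speed (real n) y = 1"
      by eventually_elim (auto intro: inv_speed_edge)
    then show "(\<lambda>n. inv_speed (real n) y) \<longlonglongrightarrow> 1" by (rule tendsto_eventually)
  qed auto
  then show ?thesis by simp
qed

text \<open>Intermediate values between \<open>lift 0\<close>, which is 1/e, and the limit 0 at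
  infinity.\<close>

lemma lift_surj:
  assumes "0 < q" "q < exp (- 1)"
  obtains b where "0 < b" "lift b = q"
proof -
  have "inv_speed 0 = (\<lambda>_. exp 1)" by (simp add: fun_eq_iff)
  then have l0: "lift 0 = exp (- 1)" by (simp add: lift_def exp_minus inverse_eq_divide)
  have "\<forall>\<^sub>F n in sequentially. lift (real n) < q"
    using lift_at_top assms(1) by (rule order_tendstoD)
  then obtain n where n: "lift (real n) < q" by (auto simp: eventually_sequentially)
  obtain b where "0 \<le> b" "lift b = q"
    using IVT2'[of lift "real n" q 0] n l0 assms continuous_on_subset[OF continuous_on_lift, of "{0..real n}"] by auto
  then show thesis using l0 assms by (intro that[of b]) (auto simp: less_le)
qed

subsection \<open>Minimal drag\<close>

lemma xlnx_ge:
  fixes x :: real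
  assumes "0 \<le> x"
  shows "0 \<le> exp (- 1) + x * ln x" and "exp (- 1) + x * ln x = 0 \<Longrightarrow> x = exp (- 1)"
proof -
  have *: "0 \<le> exp (- 1) + x * ln x \<and> (exp (- 1) + x * ln x = 0 \<longrightarrow> x = exp (- 1))"
  proof (cases "x = 0")
    case False
    then have x: "0 < x" using assms by simp
    \<comment> \<open>In terms of z the expression is x (exp z - 1 - z), whose only zero is z = 0,
      that is x = 1/e.\<close>
    define z where "z = - 1 - ln x"
    have "exp (- 1) = x * exp z" using x by (simp add: z_def exp_diff exp_minus)
    then have "exp (- 1) + x * ln x = x * (exp z - (1 + z))"
      by (simp add: z_def algebra_simps)
    moreover have "0 \<le> exp z - (1 + z)" using exp_ge_add_one_self[of z] by simp
    moreover have "z = 0" if "exp z = 1 + z"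
    proof -
      have "ln (exp z) = exp z - 1" unfolding ln_exp using that by simp
      then have "exp z = 1" by (intro ln_eq_minus_one) auto
      then show ?thesis by simp
    qed
    moreover have "x = exp (- 1)" if "z = 0"
      using x that by (simp add: z_def flip: exp_ln)
    ultimately show ?thesis using x by auto
  qed simp
  then show "0 \<le> exp (- 1) + x * ln x" "exp (- 1) + x * ln x = 0 \<Longrightarrow> x = exp (- 1)" by auto
qed

lemma profile_const:
  assumes "a \<in> {0..1}"
  shows "profile (\<lambda>_. a)" "I_fun (\<lambda>_. a) = - (a * ln a)"
  using assms by (auto simp: profile_def I_fun_def measure_restrict_space)

text \<open>Writing the deficit 1/e - I as the integral of a nonnegative function yields both the
  upper bound for I and the case of equality.\<close>

lemma I_fun_gap:
  assumes u: "profile u"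
  shows "integrable (lebesgue_on {0..1}) (\<lambda>s. exp (- 1) + u s * ln (u s))"
    and "(LINT s|lebesgue_on {0..1}. exp (- 1) + u s * ln (u s)) = exp (- 1) - I_fun u"
proof -
  have c: "integrable (lebesgue_on {0..1::real}) (\<lambda>_. exp (- 1) :: real)"
    by (intro integrable_bounded_unit) auto
  show "integrable (lebesgue_on {0..1}) (\<lambda>s. exp (- 1) + u s * ln (u s))"
    by (intro Bochner_Integration.integrable_add c I_fun_integrable u)
  show "(LINT s|lebesgue_on {0..1}. exp (- 1) + u s * ln (u s)) = exp (- 1) - I_fun u"
    by (subst Bochner_Integration.integral_add[OF c I_fun_integrable[OF u]])
      (simp add: I_fun_def measure_restrict_space)
qed

lemma I_fun_le:
  assumes u: "profile u"
  shows "I_fun u \<le> exp (- 1)"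
proof -
  have "0 \<le> (LINT s|lebesgue_on {0..1}. exp (- 1) + u s * ln (u s))"
    using profile_range[OF u] by (intro integral_nonneg_AE AE_I2 xlnx_ge) auto
  then show ?thesis using I_fun_gap(2)[OF u] by simp
qed

lemma profile_ln_le:
  assumes "profile u" "s \<in> {0..1}"
  shows "u s * ln (u s) \<le> 0"
  using profile_range[OF assms] by (cases "u s = 0") (auto intro: mult_nonneg_nonpos)

lemma I_fun_nonneg:
  assumes u: "profile u"
  shows "0 \<le> I_fun u"
  unfolding I_fun_def Bochner_Integration.integral_minus[symmetric]
  using profile_ln_le[OF u] by (intro integral_nonneg_AE AE_I2) auto

text \<open>The mass is at most 1, so the weight 1 / sqrt(mass) is at least 1. The bound supplies
  the positivity of J used below.\<close>

lemma J_fun_ge: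
  assumes u: "profile u"
  shows "I_fun u \<le> J_fun u"
proof -
  have "(LINT s|lebesgue_on {0..1}. u s * ln (u s) / sqrt (mass u s)) \<le> (LINT s|lebesgue_on {0..1}. u s * ln (u s))"
  proof (rule integral_mono_AE)
    \<comment> \<open>Only almost everywhere: at zero mass the quotient is 0 by default and could
      exceed the right-hand side.\<close>
    show "AE s in lebesgue_on {0..1}. u s * ln (u s) / sqrt (mass u s) \<le> u s * ln (u s)"
      using AE_mass_pos[OF u] AE_space
    proof eventually_elim
      fix s assume "u s = 0 \<or> 0 < mass u s" and "s \<in> space (lebesgue_on {0..1})"
      then have s: "s \<in> {0..1}" by simp
      from \<open>u s = 0 \<or> 0 < mass u s\<close> show "u s * ln (u s) / sqrt (mass u s) \<le> u s * ln (u s)"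
      proof
        assume p: "0 < mass u s"
        then have "1 \<le> 1 / sqrt (mass u s)" using mass_bounds[OF u s] s by simp
        then have "u s * ln (u s) * (1 / sqrt (mass u s)) \<le> u s * ln (u s) * 1"
          using profile_ln_le[OF u s] by (rule mult_left_mono_neg)
        then show ?thesis by simp
      qed simp
    qed
  qed (intro J_integrable I_fun_integrable u)+
  then show ?thesis by (simp add: I_fun_def J_fun_mass)
qed

text \<open>At the maximal lift the deficit vanishes, which forces \<open>u = 1/e\<close> almost
  everywhere. This endpoint corresponds to b = 0, where l = 0 and the locale \<open>extremal\<close>
  does not apply.\<close>

lemma max_lift_unique:
  assumes u: "profile u" and I: "I_fun u = exp (- 1)"
  shows "J_fun u = J_fun (\<lambda>_. exp (- 1))"
proof -
  have "AE s in lebesgue_on {0..1}. exp (- 1) + u s * ln (u s) = 0"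
  proof (subst integral_nonneg_eq_0_iff_AE[symmetric])
    show "AE s in lebesgue_on {0..1}. 0 \<le> exp (- 1) + u s * ln (u s)"
      using profile_range[OF u] by (intro AE_I2 xlnx_ge) auto
  qed (use I_fun_gap[OF u] I in auto)
  then have ae: "AE s in lebesgue_on {0..1}. u s = exp (- 1)"
    using AE_space by eventually_elim (use xlnx_ge(2) profile_range[OF u] in auto)
  let ?a = "\<lambda>_::real. exp (- 1) :: real"
  have a: "profile ?a" by (rule profile_const) auto
  have mass: "mass u s = mass ?a s" if "s \<in> {0..1}" for s
    unfolding mass_def
  proof (rule integral_cong_AE)
    have "AE x in lebesgue. x \<in> {0..s} \<longrightarrow> u x = exp (- 1)"
      using ae that by (auto simp: AE_restrict_space_iff)
    then show "AE x in lebesgue_on {0..s}. u x = exp (- 1)"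
      by (simp add: AE_restrict_space_iff)
  qed (use that in \<open>auto intro: profile_measurable u\<close>)
  have "(LINT s|lebesgue_on {0..1}. u s * ln (u s) / sqrt (mass u s))
      = (LINT s|lebesgue_on {0..1}. ?a s * ln (?a s) / sqrt (mass ?a s))"
  proof (rule integral_cong_AE)
    show "AE s in lebesgue_on {0..1}. u s * ln (u s) / sqrt (mass u s) = ?a s * ln (?a s) / sqrt (mass ?a s)"
      using ae AE_space by eventually_elim (simp add: mass)
  qed (intro borel_measurable_integrable J_integrable u a)+
  then show ?thesis by (simp only: J_fun_mass)
qed

lemma J_min_exists:
  assumes "0 < q" "q \<le> exp (- 1)"
  shows "\<exists>u. profile u \<and> I_fun u = q \<and> (\<forall>v. profile v \<and> I_fun v = q \<longrightarrow> J_fun u \<le> J_fun v)"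
proof (cases "q = exp (- 1)")
  case True
  show ?thesis
  proof (intro exI[of _ "\<lambda>_. exp (- 1)"] conjI allI impI)
    show "profile (\<lambda>_. exp (- 1))" "I_fun (\<lambda>_. exp (- 1)) = q"
      using profile_const[of "exp (- 1)"] True by auto
    show "J_fun (\<lambda>_. exp (- 1)) \<le> J_fun v" if "profile v \<and> I_fun v = q" for v
      using max_lift_unique[of v] that True by simp
  qed
next
  case False
  then have "q < exp (- 1)" using assms by simp
  then obtain b where b: "0 < b" "lift b = q" using lift_surj[OF assms(1)] by blast
  interpret extremal "inv_speed b" "exp 1 * (1 + b)" "exp 1 * b" by (rule extremal_inv_speed[OF b(1)])
  have AT: "A / T = q" using b by (simp add: lift_def A_def T_def)
  then have "0 < A" using assms T_ge_1 by (auto simp: zero_less_divide_iff)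
  then show ?thesis
    using optimal_profile[OF inv_speed_le_exp_1 _ inv_speed_identity[OF b(1)]] b AT by auto
qed

lemma J_min:
  assumes "0 < q" "q \<le> exp (- 1)"
  shows "is_minimum {J_fun u |u. profile u \<and> I_fun u = q} (J_min q)"
proof -
  obtain u where "profile u" "I_fun u = q" "\<forall>v. profile v \<and> I_fun v = q \<longrightarrow> J_fun u \<le> J_fun v"
    using J_min_exists[OF assms] by blast
  then have "is_minimum {J_fun u |u. profile u \<and> I_fun u = q} (J_fun u)"
    by (auto simp: is_minimum_def)
  \<comment> \<open>Existence comes from the minimiser, and antisymmetry makes the description
    \<open>THE\<close> unique.\<close>
  then show ?thesis
    unfolding J_min_def by (rule theI) (use \<open>is_minimum _ (J_fun u)\<close> in \<open>auto simp: is_minimum_def intro!: antisym\<close>)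
qed

lemma J_min_le:
  assumes "0 < q" "q \<le> exp (- 1)" and u: "profile u" and t: "0 < t" "t \<le> 1" "q \<le> t * I_fun u"
  shows "J_min q \<le> sqrt t * J_fun u"
proof -
  \<comment> \<open>The ratio r is the compression that brings the lift down to exactly q; r is at
    most t, so its drag factor sqrt r is at most sqrt t.\<close>
  define r where "r = q / I_fun u"
  have I: "0 < I_fun u"
    using assms I_fun_nonneg[OF u] by (cases "I_fun u = 0") auto
  then have r: "0 < r" "r \<le> t" "r * I_fun u = q"
    using assms by (auto simp: r_def field_simps)
  have "J_min q \<le> J_fun (squeeze r u)"
    using J_min[OF assms(1,2)] profile_squeeze[OF u, of r] I_fun_squeeze[OF u, of r] r t
    by (auto simp: is_minimum_def)
  also have "\<dots> = sqrt r * J_fun u"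
    using r t by (intro J_fun_squeeze u) auto
  also have "\<dots> \<le> sqrt t * J_fun u"
    using r I J_fun_ge[OF u] by (intro mult_right_mono) auto
  finally show ?thesis .
qed

section \<open>Reduction of admissible triples to single profiles\<close>

lemma C_D_ge:
  assumes ad: "admissible \<epsilon> u\<^sub>1 u\<^sub>2" and q: "0 < q" "C_L \<epsilon> u\<^sub>1 u\<^sub>2 = 2 * q"
  shows "q \<le> exp (- 1)" "1 / (2 * pi) * (J_min q)\<^sup>2 \<le> C_D \<epsilon> u\<^sub>1 u\<^sub>2" "0 < J_min q"
proof -
  have e: "0 \<le> \<epsilon>" "\<epsilon> < 1" and u: "profile u\<^sub>1" "profile u\<^sub>2" using ad by (auto simp: admissible_def)
  \<comment> \<open>Dropping the lift term of \<open>u\<^sub>1\<close>, which enters with a negative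
    sign, can only raise the value.\<close>
  have le: "q \<le> (1 - \<epsilon>) * I_fun u\<^sub>2"
  proof -
    have "0 \<le> \<epsilon> * I_fun u\<^sub>1" using e I_fun_nonneg[OF u(1)] by simp
    moreover have "(1 - \<epsilon>) * I_fun u\<^sub>2 - \<epsilon> * I_fun u\<^sub>1 = q"
      using q(2) unfolding C_L_def by (subst (asm) mult_left_cancel) simp_all
    ultimately show ?thesis by (simp add: diff_eq_eq)
  qed
  also have "\<dots> \<le> 1 * exp (- 1)"
    using e I_fun_le[OF u(2)] I_fun_nonneg[OF u(2)] by (intro mult_mono) auto
  finally show qe: "q \<le> exp (- 1)" by simp
  \<comment> \<open>The compression bound is applied with t = 1 - \<epsilon>, which is positive as
    \<epsilon> < 1.\<close>
  have "J_min q \<le> sqrt (1 - \<epsilon>) * J_fun u\<^sub>2"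
    using e le by (intro J_min_le q(1) qe u) auto
  also have "\<dots> \<le> sqrt (1 - \<epsilon>) * J_fun u\<^sub>2 + sqrt \<epsilon> * J_fun u\<^sub>1"
    using e J_fun_ge[OF u(1)] I_fun_nonneg[OF u(1)] by simp
  finally have J: "J_min q \<le> sqrt (1 - \<epsilon>) * J_fun u\<^sub>2 + sqrt \<epsilon> * J_fun u\<^sub>1" .
  obtain u where "profile u" "I_fun u = q" "J_min q = J_fun u"
    using J_min[OF q(1) qe] by (auto simp: is_minimum_def)
  then show J0: "0 < J_min q" using J_fun_ge[of u] q by simp
  have "(J_min q)\<^sup>2 \<le> (sqrt (1 - \<epsilon>) * J_fun u\<^sub>2 + sqrt \<epsilon> * J_fun u\<^sub>1)\<^sup>2"
    using J J0 by (intro power_mono) auto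
  then show "1 / (2 * pi) * (J_min q)\<^sup>2 \<le> C_D \<epsilon> u\<^sub>1 u\<^sub>2"
    unfolding C_D_def by (intro mult_left_mono) auto
qed

lemma C_L_le:
  assumes "admissible \<epsilon> u\<^sub>1 u\<^sub>2"
  shows "C_L \<epsilon> u\<^sub>1 u\<^sub>2 \<le> 2 / exp 1"
proof (cases "0 < C_L \<epsilon> u\<^sub>1 u\<^sub>2")
  case True
  then show ?thesis
    using C_D_ge(1)[OF assms, of "C_L \<epsilon> u\<^sub>1 u\<^sub>2 / 2"] by (simp add: exp_minus field_simps)
next
  case False
  moreover have "0 \<le> 2 / exp (1 :: real)" by simp
  ultimately show ?thesis by linarith
qed

lemma minimum_drag:
  assumes "0 < c" "c \<le> 2 / exp 1"
  obtains \<epsilon> u\<^sub>1 u\<^sub>2 where "admissible \<epsilon> u\<^sub>1 u\<^sub>2" "C_L \<epsilon> u\<^sub>1 u\<^sub>2 = c"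
    "C_D \<epsilon> u\<^sub>1 u\<^sub>2 = 1 / (2 * pi) * (J_min (c / 2))\<^sup>2"
proof -
  have "c / 2 \<le> exp (- 1)" using assms by (simp add: exp_minus field_simps)
  then obtain u where "profile u" "I_fun u = c / 2" "J_min (c / 2) = J_fun u"
    using J_min[of "c / 2"] assms by (auto simp: is_minimum_def)
  then show thesis
    \<comment> \<open>At \<epsilon> = 0 the terms of the first profile have weight 0, so any profile
      can stand in its place; \<open>u\<close> is at hand.\<close>
    by (intro that[of 0 u u]) (auto simp: admissible_def C_L_def C_D_def)
qed

theorem theorem2:
  shows "is_maximum {C_L \<epsilon> u\<^sub>1 u\<^sub>2 |\<epsilon> u\<^sub>1 u\<^sub>2. admissible \<epsilon> u\<^sub>1 u\<^sub>2} (2 / exp 1) \<and>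
    (\<forall>c. 0 < c \<and> c \<le> 2 / exp 1 \<longrightarrow>
      is_minimum {C_D \<epsilon> u\<^sub>1 u\<^sub>2 |\<epsilon> u\<^sub>1 u\<^sub>2. admissible \<epsilon> u\<^sub>1 u\<^sub>2 \<and> C_L \<epsilon> u\<^sub>1 u\<^sub>2 = c}
        (1 / (2 * pi) * (J_min (c / 2))\<^sup>2)) \<and>
    (\<forall>c. 0 < c \<and> c \<le> 2 / exp 1 \<longrightarrow>
      is_maximum {C_L \<epsilon> u\<^sub>1 u\<^sub>2 / C_D \<epsilon> u\<^sub>1 u\<^sub>2 |\<epsilon> u\<^sub>1 u\<^sub>2.
          admissible \<epsilon> u\<^sub>1 u\<^sub>2 \<and> C_L \<epsilon> u\<^sub>1 u\<^sub>2 = c}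
        (2 * pi * c / (J_min (c / 2))\<^sup>2))"
proof (intro conjI allI impI; (elim conjE)?)
  obtain \<epsilon> u\<^sub>1 u\<^sub>2 where "admissible \<epsilon> u\<^sub>1 u\<^sub>2" "C_L \<epsilon> u\<^sub>1 u\<^sub>2 = 2 / exp 1"
    by (rule minimum_drag[of "2 / exp 1"]) auto
  then show "is_maximum {C_L \<epsilon> u\<^sub>1 u\<^sub>2 |\<epsilon> u\<^sub>1 u\<^sub>2. admissible \<epsilon> u\<^sub>1 u\<^sub>2} (2 / exp 1)"
    using C_L_le by (auto simp: is_maximum_def) metis
next
  fix c :: real assume c: "0 < c" "c \<le> 2 / exp 1"
  obtain \<epsilon> u\<^sub>1 u\<^sub>2 where *: "admissible \<epsilon> u\<^sub>1 u\<^sub>2" "C_L \<epsilon> u\<^sub>1 u\<^sub>2 = c"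
    "C_D \<epsilon> u\<^sub>1 u\<^sub>2 = 1 / (2 * pi) * (J_min (c / 2))\<^sup>2"
    using minimum_drag[OF c] .
  have ge: "1 / (2 * pi) * (J_min (c / 2))\<^sup>2 \<le> C_D e v w" if "admissible e v w" "C_L e v w = c" for e v w
    using C_D_ge(2)[OF that(1), of "c / 2"] that(2) c by simp
  show "is_minimum {C_D \<epsilon> u\<^sub>1 u\<^sub>2 |\<epsilon> u\<^sub>1 u\<^sub>2. admissible \<epsilon> u\<^sub>1 u\<^sub>2 \<and> C_L \<epsilon> u\<^sub>1 u\<^sub>2 = c}
        (1 / (2 * pi) * (J_min (c / 2))\<^sup>2)"
    unfolding is_minimum_def
  proof (intro conjI ballI)
    show "1 / (2 * pi) * (J_min (c / 2))\<^sup>2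
        \<in> {C_D \<epsilon> u\<^sub>1 u\<^sub>2 |\<epsilon> u\<^sub>1 u\<^sub>2. admissible \<epsilon> u\<^sub>1 u\<^sub>2 \<and> C_L \<epsilon> u\<^sub>1 u\<^sub>2 = c}"
      unfolding *(3)[symmetric] using *(1,2) by blast
  qed (use ge in blast)
  have "0 < J_min (c / 2)" using C_D_ge(3)[OF *(1), of "c / 2"] * c by simp
  \<comment> \<open>Positive minimal drag is what lets a lower bound on the drag pass to an upper
    bound on the quotient.\<close>
  then have pos: "0 < 1 / (2 * pi) * (J_min (c / 2))\<^sup>2" by simp
  have eq: "2 * pi * c / (J_min (c / 2))\<^sup>2 = c / (1 / (2 * pi) * (J_min (c / 2))\<^sup>2)" by simp
  show "is_maximum {C_L \<epsilon> u\<^sub>1 u\<^sub>2 / C_D \<epsilon> u\<^sub>1 u\<^sub>2 |\<epsilon> u\<^sub>1 u\<^sub>2.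
          admissible \<epsilon> u\<^sub>1 u\<^sub>2 \<and> C_L \<epsilon> u\<^sub>1 u\<^sub>2 = c}
        (2 * pi * c / (J_min (c / 2))\<^sup>2)"
    unfolding is_maximum_def eq
  proof (intro conjI ballI)
    show "c / (1 / (2 * pi) * (J_min (c / 2))\<^sup>2) \<in> {C_L \<epsilon> u\<^sub>1 u\<^sub>2 / C_D \<epsilon> u\<^sub>1 u\<^sub>2 |\<epsilon> u\<^sub>1 u\<^sub>2.
          admissible \<epsilon> u\<^sub>1 u\<^sub>2 \<and> C_L \<epsilon> u\<^sub>1 u\<^sub>2 = c}"
      unfolding *(3)[symmetric] mem_Collect_eq using *(1,2) by metis
    fix x assume "x \<in> {C_L \<epsilon> u\<^sub>1 u\<^sub>2 / C_D \<epsilon> u\<^sub>1 u\<^sub>2 |\<epsilon> u\<^sub>1 u\<^sub>2.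
          admissible \<epsilon> u\<^sub>1 u\<^sub>2 \<and> C_L \<epsilon> u\<^sub>1 u\<^sub>2 = c}"
    then obtain e v w where x: "x = c / C_D e v w" and *: "admissible e v w" "C_L e v w = c" by auto
    show "x \<le> c / (1 / (2 * pi) * (J_min (c / 2))\<^sup>2)"
      unfolding x by (rule frac_le[OF _ order_refl pos ge[OF *]]) (use c in simp)
  qed
qed

end
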